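(* Let $(\tilde L,\tilde\alpha,\tilde\pi,[,],D)$ be a $D$-Lie algebra and let $(E,\rho)$ be an $\tilde L$-connection with $\rho(D)=\operatorname{Id}_E$. Let $\operatorname{End}(\tilde L,E)$ be the non-abelian extension of $\tilde L$ with $\rho$. There is a canonical flat connection $$\rho^!:\operatorname{End}(\tilde L,E)\to\operatorname{Diff}^1(E)$$ defined by $\rho^!(\phi,u):=\phi+\rho(u)$. The exact sequence $$0\to\operatorname{End}_A(E)\to\operatorname{End}(\tilde L,E)\xrightarrow{p_E}\tilde L\to 0,\qquad p_E(\phi,u):=u,$$ is split in the category of $D$-Lie algebras (that is, there is a map of $D$-Lie algebras $s:\tilde L\to\operatorname{End}(\tilde L,E)$ with $p_E\circ s=\operatorname{Id}_{\tilde L}$) if and only if $E$ has a flat $\tilde L$-connection $\rho':\tilde L\to\operatorname{Diff}^1(E)$ with $\rho'(D)=\operatorname{Id}_E$.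
   Context: $k$ is a commutative unital ring and $A$ a commutative unital $k$-algebra. $I$ is the kernel of the multiplication $A\otimes_k A\to A$ and $P:=A\otimes_k A/I^2$. A left $P$-module is a left $A\otimes_k A$-module annihilated by $I^2$; write $cu:=(c\otimes 1)u$, $uc:=(1\otimes c)u$ and $dc:=1\otimes c-c\otimes 1$, so $dc\cdot u=uc-cu$. $\operatorname{Der}_k(A)$ is a $P$-module with $xc:=cx$. For a 2-cocycle $f\in Z^2(\operatorname{Der}_k(A),A)$ of the Lie-Rinehart complex $\operatorname{Hom}_A(\wedge^p_A\operatorname{Der}_k(A),A)$, $D^1(A,f):=A\oplus\operatorname{Der}_k(A)$ with $[(a,x),(b,y)]:=(x(b)-y(a)+f(x,y),[x,y])$, $c(a,x):=(ca,cx)$, $(a,x)c:=(ac+x(c),cx)$ and $\pi(a,x):=x$; it is a $k$-Lie algebra and left $P$-module. A $D$-Lie algebra (relative to $f$) is a 5-tuple $(\tilde L,\tilde\alpha,\tilde\pi,[,],D)$ where $\tilde L$ is a $k$-Lie algebra and left $P$-module, $\tilde\alpha:\tilde L\to D^1(A,f)$ and $\tilde\pi:\tilde L\to\operatorname{Der}_k(A)$ are maps of $P$-modules and $k$-Lie algebras with $\tilde\pi=\pi\circ\tilde\alpha$, $[u,av]=a[u,v]+\tilde\pi(u)(a)v$, $da\cdot u=\tilde\pi(u)(a)D$ for all $u,v\in\tilde L$, $a\in A$, and $D\in\tilde L$ is a central element with $\tilde\pi(D)=0$. A map of $D$-Lie algebras $\phi:\tilde L\to\tilde L'$ is a map of left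 $P$-modules and $k$-Lie algebras with $\phi(D)=D'$ and $\tilde\pi=\tilde\pi'\circ\phi$. For a left $A$-module $E$, $\operatorname{Diff}^1(E)$ is the set of $\partial\in\operatorname{End}_k(E)$ with $[[\partial,a],b]=0$ for all $a,b\in A$; it is a left $P$-module by $(a\otimes b\cdot\partial)(e):=a\partial(be)$. An $\tilde L$-connection is a pair $(E,\rho)$ with $\rho:\tilde L\to\operatorname{Diff}^1(E)$ a map of left $P$-modules; its curvature is $R_\rho(u,v):=[\rho(u),\rho(v)]-\rho([u,v])$, and it is flat if $R_\rho=0$. For an $\tilde L$-connection $(E,\rho)$ with $\rho(D)=\operatorname{Id}_E$, $\operatorname{End}(\tilde L,E):=\operatorname{End}_A(E)\oplus\tilde L$ is the $D$-Lie algebra with $c(\phi,u):=(c\phi,cu)$, $(\phi,u)c:=(\phi c,uc)$, $\alpha_E(\phi,u):=\tilde\alpha(u)\in D^1(A,f)$, $\pi_E(\phi,u):=\tilde\pi(u)$, central element $\tilde D:=(0,D)$ and bracket $$[(\phi,u),(\psi,v)]:=([\phi,\psi]+[\rho(u),\psi]-[\rho(v),\phi]+R_\rho(u,v),[u,v]).$$ *)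

theory Defs
  imports "HOL-Library.Poly_Mapping" "HOL-Algebra.Module" "HOL-Algebra.QuotRing" "HOL-Algebra.Ideal_Product"
begin

section \<open>The ring \<open>A \<otimes>\<^sub>k A\<close> and its modules\<close>

text \<open>
  Throughout, \<open>k\<close> is a commutative ring and \<open>A\<close> a commutative \<open>k\<close>-algebra (library locale
  \<^locale>\<open>algebra\<close>). Sets of endomaps consist of functions that are extensional
  on the carrier, so that equality of elements is equality of maps on the carrier.

  The library has no tensor product. As a ring, \<open>A \<otimes>\<^sub>k A\<close> is the ring of formal integral
  combinations of pairs, with \<open>(a, b) (c, d) = (a c, b d)\<close>, modulo the bilinearity relations. The
  additive span of these relations is stable under multiplication by pairs, so the ideal they
  generate is the usual subgroup of relations.
\<close>

type_synonym 'a formal = "('a \<times> 'a) \<Rightarrow>\<^sub>0 int"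
type_synonym 'a tensor = "'a formal set"

definition formal_ring :: "('a, 'y) ring_scheme \<Rightarrow> 'a formal ring" where
  "formal_ring A =
    \<lparr>carrier = {x. Poly_Mapping.keys x \<subseteq> carrier A \<times> carrier A},
     mult = (\<lambda>x y. frag_extend (\<lambda>(a, b).
               frag_extend (\<lambda>(c, d). frag_of (a \<otimes>\<^bsub>A\<^esub> c, b \<otimes>\<^bsub>A\<^esub> d)) y) x),
     one = frag_of (\<one>\<^bsub>A\<^esub>, \<one>\<^bsub>A\<^esub>),
     zero = 0,
     add = (+)\<rparr>"

definition tensor_rels :: "('k, 'x) ring_scheme \<Rightarrow> ('k, 'a, 'y) module_scheme \<Rightarrow> 'a formal set" where
  "tensor_rels k A =
     {frag_of (a \<oplus>\<^bsub>A\<^esub> a', b) - frag_of (a, b) - frag_of (a', b) | a a' b.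
        a \<in> carrier A \<and> a' \<in> carrier A \<and> b \<in> carrier A}
   \<union> {frag_of (a, b \<oplus>\<^bsub>A\<^esub> b') - frag_of (a, b) - frag_of (a, b') | a b b'.
        a \<in> carrier A \<and> b \<in> carrier A \<and> b' \<in> carrier A}
   \<union> {frag_of (s \<odot>\<^bsub>A\<^esub> a, b) - frag_of (a, s \<odot>\<^bsub>A\<^esub> b) | s a b.
        s \<in> carrier k \<and> a \<in> carrier A \<and> b \<in> carrier A}"

definition tensor_ideal :: "('k, 'x) ring_scheme \<Rightarrow> ('k, 'a, 'y) module_scheme \<Rightarrow> 'a formal set" where
  "tensor_ideal k A = genideal (formal_ring A) (tensor_rels k A)"

definition tensor_ring :: "('k, 'x) ring_scheme \<Rightarrow> ('k, 'a, 'y) module_scheme \<Rightarrow> 'a tensor ring" where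
  "tensor_ring k A = formal_ring A Quot tensor_ideal k A"

definition tens :: "('k, 'x) ring_scheme \<Rightarrow> ('k, 'a, 'y) module_scheme \<Rightarrow> 'a \<Rightarrow> 'a \<Rightarrow> 'a tensor" where
  "tens k A a b = tensor_ideal k A +>\<^bsub>formal_ring A\<^esub> frag_of (a, b)"

text \<open>
  The additive map \<open>A \<otimes>\<^sub>k A \<rightarrow> M\<close> with \<open>a \<otimes> b \<mapsto> g a b\<close>, computed on a
  representative; it is only used for \<open>g\<close> biadditive and \<open>k\<close>-balanced, where the choice is
  immaterial.
\<close>

definition tensor_lift :: "('m, 'z) ring_scheme \<Rightarrow> ('a \<Rightarrow> 'a \<Rightarrow> 'm) \<Rightarrow> 'a tensor \<Rightarrow> 'm" where
  "tensor_lift M g t = (let x = (SOME x. x \<in> t) in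
     (\<Oplus>\<^bsub>M\<^esub>p \<in> Poly_Mapping.keys x. add_pow M (Poly_Mapping.lookup x p) (g (fst p) (snd p))))"

definition mult_kernel :: "('k, 'x) ring_scheme \<Rightarrow> ('k, 'a, 'y) module_scheme \<Rightarrow> 'a tensor set" where
  "mult_kernel k A = a_kernel (tensor_ring k A) A (tensor_lift A (\<lambda>a b. a \<otimes>\<^bsub>A\<^esub> b))"

definition P_module ::
  "('k, 'x) ring_scheme \<Rightarrow> ('k, 'a, 'y) module_scheme \<Rightarrow> ('a tensor, 'm, 'z) module_scheme \<Rightarrow> bool" where
  "P_module k A M \<longleftrightarrow> module (tensor_ring k A) M \<and>
     (\<forall>t \<in> ideal_prod (tensor_ring k A) (mult_kernel k A) (mult_kernel k A).
        \<forall>u \<in> carrier M. t \<odot>\<^bsub>M\<^esub> u = \<zero>\<^bsub>M\<^esub>)"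

definition lact where
  "lact k A M c u = tens k A c \<one>\<^bsub>A\<^esub> \<odot>\<^bsub>M\<^esub> u"

definition dact where
  "dact k A M c u =
     (tens k A \<one>\<^bsub>A\<^esub> c \<ominus>\<^bsub>tensor_ring k A\<^esub> tens k A c \<one>\<^bsub>A\<^esub>) \<odot>\<^bsub>M\<^esub> u"

text \<open>The \<open>A \<otimes>\<^sub>k A\<close>-module on an abelian group with \<open>(a \<otimes> b) m = a (m b)\<close>, for given left
  and right multiplications \<open>l\<close>, \<open>r\<close>.\<close>

definition bimodule ::
  "'m ring \<Rightarrow> ('a \<Rightarrow> 'm \<Rightarrow> 'm) \<Rightarrow> ('a \<Rightarrow> 'm \<Rightarrow> 'm) \<Rightarrow> ('a tensor, 'm) module" where
  "bimodule G l r =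
    \<lparr>carrier = carrier G, mult = monoid.mult G, one = monoid.one G, zero = ring.zero G, add = add G,
     smult = (\<lambda>t m. tensor_lift G (\<lambda>a b. l a (r b m)) t)\<rparr>"

definition mod_hom ::
  "('r, 'x) ring_scheme \<Rightarrow> ('r, 'm, 'y) module_scheme \<Rightarrow> ('r, 'n, 'z) module_scheme \<Rightarrow> ('m \<Rightarrow> 'n) set" where
  "mod_hom R M N = {h \<in> carrier M \<rightarrow> carrier N.
     (\<forall>x \<in> carrier M. \<forall>y \<in> carrier M. h (x \<oplus>\<^bsub>M\<^esub> y) = h x \<oplus>\<^bsub>N\<^esub> h y) \<and>
     (\<forall>r \<in> carrier R. \<forall>x \<in> carrier M. h (r \<odot>\<^bsub>M\<^esub> x) = r \<odot>\<^bsub>N\<^esub> h x)}"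

definition short_exact ::
  "('r, 'x) ring_scheme \<Rightarrow> ('r, 'm1, 'y1) module_scheme \<Rightarrow> ('m1 \<Rightarrow> 'm2) \<Rightarrow>
   ('r, 'm2, 'y2) module_scheme \<Rightarrow> ('m2 \<Rightarrow> 'm3) \<Rightarrow> ('r, 'm3, 'y3) module_scheme \<Rightarrow> bool" where
  "short_exact R M1 i M2 p M3 \<longleftrightarrow>
     module R M1 \<and> module R M2 \<and> module R M3 \<and>
     i \<in> mod_hom R M1 M2 \<and> p \<in> mod_hom R M2 M3 \<and>
     inj_on i (carrier M1) \<and> i ` carrier M1 = a_kernel M2 M3 p \<and> p ` carrier M2 = carrier M3"

section \<open>Lie algebras\<close>

text \<open>The \<open>k\<close>-module underlying an \<open>A \<otimes>\<^sub>k A\<close>-module.\<close>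

definition k_module ::
  "('k, 'x) ring_scheme \<Rightarrow> ('k, 'a, 'y) module_scheme \<Rightarrow> ('a tensor, 'm, 'z) module_scheme
    \<Rightarrow> ('k, 'm) module" where
  "k_module k A M =
    \<lparr>carrier = carrier M, mult = mult M, one = one M, zero = zero M, add = add M,
     smult = (\<lambda>s u. lact k A M (s \<odot>\<^bsub>A\<^esub> \<one>\<^bsub>A\<^esub>) u)\<rparr>"

locale lie_algebra = module k M for k (structure) and M (structure) +
  fixes br :: "'m \<Rightarrow> 'm \<Rightarrow> 'm"
  assumes br_closed: "u \<in> carrier M \<Longrightarrow> v \<in> carrier M \<Longrightarrow> br u v \<in> carrier M"
    and br_add_left: "u \<in> carrier M \<Longrightarrow> v \<in> carrier M \<Longrightarrow> w \<in> carrier M \<Longrightarrow>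
      br (u \<oplus>\<^bsub>M\<^esub> v) w = br u w \<oplus>\<^bsub>M\<^esub> br v w"
    and br_add_right: "u \<in> carrier M \<Longrightarrow> v \<in> carrier M \<Longrightarrow> w \<in> carrier M \<Longrightarrow>
      br u (v \<oplus>\<^bsub>M\<^esub> w) = br u v \<oplus>\<^bsub>M\<^esub> br u w"
    and br_smult_left: "s \<in> carrier k \<Longrightarrow> u \<in> carrier M \<Longrightarrow> v \<in> carrier M \<Longrightarrow>
      br (s \<odot>\<^bsub>M\<^esub> u) v = s \<odot>\<^bsub>M\<^esub> br u v"
    and br_smult_right: "s \<in> carrier k \<Longrightarrow> u \<in> carrier M \<Longrightarrow> v \<in> carrier M \<Longrightarrow>
      br u (s \<odot>\<^bsub>M\<^esub> v) = s \<odot>\<^bsub>M\<^esub> br u v"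
    and br_alt: "u \<in> carrier M \<Longrightarrow> br u u = \<zero>\<^bsub>M\<^esub>"
    and br_jacobi: "u \<in> carrier M \<Longrightarrow> v \<in> carrier M \<Longrightarrow> w \<in> carrier M \<Longrightarrow>
      br u (br v w) \<oplus>\<^bsub>M\<^esub> br v (br w u) \<oplus>\<^bsub>M\<^esub> br w (br u v) = \<zero>\<^bsub>M\<^esub>"

section \<open>Derivations, \<open>2\<close>-cocycles and \<open>D\<^sup>1(A, f)\<close>\<close>

definition fun_ring :: "('e, 'z) ring_scheme \<Rightarrow> ('e \<Rightarrow> 'e) set \<Rightarrow> ('e \<Rightarrow> 'e) ring" where
  "fun_ring E X =
    \<lparr>carrier = X,
     mult = (\<lambda>g h. compose (carrier E) g h),
     one = (\<lambda>e \<in> carrier E. e),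
     zero = (\<lambda>e \<in> carrier E. \<zero>\<^bsub>E\<^esub>),
     add = (\<lambda>g h. \<lambda>e \<in> carrier E. g e \<oplus>\<^bsub>E\<^esub> h e)\<rparr>"

definition Der :: "('k, 'x) ring_scheme \<Rightarrow> ('k, 'a, 'y) module_scheme \<Rightarrow> ('a \<Rightarrow> 'a) set" where
  "Der k A = {x \<in> carrier A \<rightarrow>\<^sub>E carrier A.
     (\<forall>a \<in> carrier A. \<forall>b \<in> carrier A. x (a \<oplus>\<^bsub>A\<^esub> b) = x a \<oplus>\<^bsub>A\<^esub> x b) \<and>
     (\<forall>s \<in> carrier k. \<forall>a \<in> carrier A. x (s \<odot>\<^bsub>A\<^esub> a) = s \<odot>\<^bsub>A\<^esub> x a) \<and>
     (\<forall>a \<in> carrier A. \<forall>b \<in> carrier A. x (a \<otimes>\<^bsub>A\<^esub> b) = x a \<otimes>\<^bsub>A\<^esub> b \<oplus>\<^bsub>A\<^esub> a \<otimes>\<^bsub>A\<^esub> x b)}"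

definition der_add :: "('a, 'y) ring_scheme \<Rightarrow> ('a \<Rightarrow> 'a) \<Rightarrow> ('a \<Rightarrow> 'a) \<Rightarrow> 'a \<Rightarrow> 'a" where
  "der_add A x y = (\<lambda>a \<in> carrier A. x a \<oplus>\<^bsub>A\<^esub> y a)"

definition der_smult :: "('a, 'y) ring_scheme \<Rightarrow> 'a \<Rightarrow> ('a \<Rightarrow> 'a) \<Rightarrow> 'a \<Rightarrow> 'a" where
  "der_smult A c x = (\<lambda>a \<in> carrier A. c \<otimes>\<^bsub>A\<^esub> x a)"

definition der_lie :: "('a, 'y) ring_scheme \<Rightarrow> ('a \<Rightarrow> 'a) \<Rightarrow> ('a \<Rightarrow> 'a) \<Rightarrow> 'a \<Rightarrow> 'a" where
  "der_lie A x y = (\<lambda>a \<in> carrier A. x (y a) \<ominus>\<^bsub>A\<^esub> y (x a))"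

definition Der_module ::
  "('k, 'x) ring_scheme \<Rightarrow> ('k, 'a, 'y) module_scheme \<Rightarrow> ('a tensor, 'a \<Rightarrow> 'a) module" where
  "Der_module k A = bimodule (fun_ring A (Der k A)) (der_smult A) (der_smult A)"

text \<open>\<open>Hom\<^sub>A(\<And>\<^sup>2 Der, A)\<close> is rendered as the alternating \<open>A\<close>-bilinear maps \<open>f(x, y)\<close>; the last
  clause is the vanishing of the Lie-Rinehart differential of \<open>f\<close>.\<close>

definition cocycles2 ::
  "('k, 'x) ring_scheme \<Rightarrow> ('k, 'a, 'y) module_scheme \<Rightarrow> (('a \<Rightarrow> 'a) \<Rightarrow> ('a \<Rightarrow> 'a) \<Rightarrow> 'a) set" where
  "cocycles2 k A = {f.
     (\<forall>x \<in> Der k A. \<forall>y \<in> Der k A. f x y \<in> carrier A) \<and>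
     (\<forall>x \<in> Der k A. \<forall>y \<in> Der k A. \<forall>z \<in> Der k A.
        f (der_add A x y) z = f x z \<oplus>\<^bsub>A\<^esub> f y z \<and>
        f z (der_add A x y) = f z x \<oplus>\<^bsub>A\<^esub> f z y) \<and>
     (\<forall>c \<in> carrier A. \<forall>x \<in> Der k A. \<forall>y \<in> Der k A.
        f (der_smult A c x) y = c \<otimes>\<^bsub>A\<^esub> f x y \<and>
        f x (der_smult A c y) = c \<otimes>\<^bsub>A\<^esub> f x y) \<and>
     (\<forall>x \<in> Der k A. f x x = \<zero>\<^bsub>A\<^esub>) \<and>
     (\<forall>x \<in> Der k A. \<forall>y \<in> Der k A. \<forall>z \<in> Der k A.
        x (f y z) \<ominus>\<^bsub>A\<^esub> y (f x z) \<oplus>\<^bsub>A\<^esub> z (f x y)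
          \<ominus>\<^bsub>A\<^esub> f (der_lie A x y) z \<oplus>\<^bsub>A\<^esub> f (der_lie A x z) y \<ominus>\<^bsub>A\<^esub> f (der_lie A y z) x = \<zero>\<^bsub>A\<^esub>)}"

text \<open>Fields \<open>mult\<close> and \<open>one\<close> of the record types carry no meaning for additive groups.\<close>

definition D1_module ::
  "('k, 'x) ring_scheme \<Rightarrow> ('k, 'a, 'y) module_scheme \<Rightarrow> ('a tensor, 'a \<times> ('a \<Rightarrow> 'a)) module" where
  "D1_module k A = bimodule
    \<lparr>carrier = carrier A \<times> Der k A, mult = undefined, one = undefined,
     zero = (\<zero>\<^bsub>A\<^esub>, \<lambda>a \<in> carrier A. \<zero>\<^bsub>A\<^esub>),
     add = (\<lambda>(a, x) (b, y). (a \<oplus>\<^bsub>A\<^esub> b, der_add A x y))\<rparr>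
    (\<lambda>c (a, x). (c \<otimes>\<^bsub>A\<^esub> a, der_smult A c x))
    (\<lambda>c (a, x). (a \<otimes>\<^bsub>A\<^esub> c \<oplus>\<^bsub>A\<^esub> x c, der_smult A c x))"

definition D1_lie ::
  "('a, 'y) ring_scheme \<Rightarrow> (('a \<Rightarrow> 'a) \<Rightarrow> ('a \<Rightarrow> 'a) \<Rightarrow> 'a) \<Rightarrow>
   'a \<times> ('a \<Rightarrow> 'a) \<Rightarrow> 'a \<times> ('a \<Rightarrow> 'a) \<Rightarrow> 'a \<times> ('a \<Rightarrow> 'a)" where
  "D1_lie A f = (\<lambda>(a, x) (b, y). (x b \<ominus>\<^bsub>A\<^esub> y a \<oplus>\<^bsub>A\<^esub> f x y, der_lie A x y))"

section \<open>\<open>D\<close>-Lie algebras\<close>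

text \<open>\<open>alpha\<close>, \<open>anchor\<close> and \<open>cent\<close> are \<open>\<alpha>\<close>, \<open>\<pi>\<close> and the central element \<open>D\<close>.\<close>

record ('a, 'l) dlie = "('a tensor, 'l) module" +
  lie :: "'l \<Rightarrow> 'l \<Rightarrow> 'l"
  alpha :: "'l \<Rightarrow> 'a \<times> ('a \<Rightarrow> 'a)"
  anchor :: "'l \<Rightarrow> 'a \<Rightarrow> 'a"
  cent :: "'l"

locale D_Lie_algebra =
  fixes k :: "('k, 'x) ring_scheme" and A :: "('k, 'a, 'y) module_scheme"
    and f :: "('a \<Rightarrow> 'a) \<Rightarrow> ('a \<Rightarrow> 'a) \<Rightarrow> 'a" and L :: "('a, 'l, 'z) dlie_scheme"
  assumes algebra: "algebra k A"
    and cocycle: "f \<in> cocycles2 k A"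
    and P_module: "P_module k A L"
    and lie_algebra: "lie_algebra k (k_module k A L) (lie L)"
    and alpha_hom: "alpha L \<in> mod_hom (tensor_ring k A) L (D1_module k A)"
    and alpha_lie: "u \<in> carrier L \<Longrightarrow> v \<in> carrier L \<Longrightarrow>
      alpha L (lie L u v) = D1_lie A f (alpha L u) (alpha L v)"
    and anchor_hom: "anchor L \<in> mod_hom (tensor_ring k A) L (Der_module k A)"
    and anchor_lie: "u \<in> carrier L \<Longrightarrow> v \<in> carrier L \<Longrightarrow>
      anchor L (lie L u v) = der_lie A (anchor L u) (anchor L v)"
    and anchor_alpha: "u \<in> carrier L \<Longrightarrow> anchor L u = snd (alpha L u)"
    and lie_leibniz: "u \<in> carrier L \<Longrightarrow> v \<in> carrier L \<Longrightarrow> a \<in> carrier A \<Longrightarrow>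
      lie L u (lact k A L a v) = lact k A L a (lie L u v) \<oplus>\<^bsub>L\<^esub> lact k A L (anchor L u a) v"
    and dact_cent: "u \<in> carrier L \<Longrightarrow> a \<in> carrier A \<Longrightarrow>
      dact k A L a u = lact k A L (anchor L u a) (cent L)"
    and cent_closed: "cent L \<in> carrier L"
    and cent_central: "u \<in> carrier L \<Longrightarrow> lie L (cent L) u = \<zero>\<^bsub>L\<^esub>"
    and cent_anchor: "anchor L (cent L) = (\<lambda>a \<in> carrier A. \<zero>\<^bsub>A\<^esub>)"

definition D_Lie_hom ::
  "('k, 'x) ring_scheme \<Rightarrow> ('k, 'a, 'y) module_scheme \<Rightarrow>
   ('a, 'l, 'z) dlie_scheme \<Rightarrow> ('a, 'm, 'w) dlie_scheme \<Rightarrow> ('l \<Rightarrow> 'm) set" where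
  "D_Lie_hom k A L L' = {\<phi> \<in> mod_hom (tensor_ring k A) L L'.
     (\<forall>u \<in> carrier L. \<forall>v \<in> carrier L. \<phi> (lie L u v) = lie L' (\<phi> u) (\<phi> v)) \<and>
     \<phi> (cent L) = cent L' \<and>
     (\<forall>u \<in> carrier L. anchor L u = anchor L' (\<phi> u))}"

section \<open>Endomorphisms, differential operators and connections\<close>

text \<open>An \<open>A\<close>-module \<open>E\<close> is a \<open>k\<close>-module by restriction of scalars along \<open>s \<mapsto> s 1\<close>.\<close>

definition End_k ::
  "('k, 'x) ring_scheme \<Rightarrow> ('k, 'a, 'y) module_scheme \<Rightarrow> ('a, 'e, 'z) module_scheme \<Rightarrow> ('e \<Rightarrow> 'e) set" where
  "End_k k A E = {g \<in> carrier E \<rightarrow>\<^sub>E carrier E.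
     (\<forall>e \<in> carrier E. \<forall>e' \<in> carrier E. g (e \<oplus>\<^bsub>E\<^esub> e') = g e \<oplus>\<^bsub>E\<^esub> g e') \<and>
     (\<forall>s \<in> carrier k. \<forall>e \<in> carrier E.
        g ((s \<odot>\<^bsub>A\<^esub> \<one>\<^bsub>A\<^esub>) \<odot>\<^bsub>E\<^esub> e) = (s \<odot>\<^bsub>A\<^esub> \<one>\<^bsub>A\<^esub>) \<odot>\<^bsub>E\<^esub> g e)}"

abbreviation End_k_ring ::
  "('k, 'x) ring_scheme \<Rightarrow> ('k, 'a, 'y) module_scheme \<Rightarrow> ('a, 'e, 'z) module_scheme \<Rightarrow> ('e \<Rightarrow> 'e) ring" where
  "End_k_ring k A E \<equiv> fun_ring E (End_k k A E)"

definition End_A :: "('a, 'y) ring_scheme \<Rightarrow> ('a, 'e, 'z) module_scheme \<Rightarrow> ('e \<Rightarrow> 'e) set" where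
  "End_A A E = mod_hom A E E \<inter> extensional (carrier E)"

definition scalar :: "('a, 'e, 'z) module_scheme \<Rightarrow> 'a \<Rightarrow> 'e \<Rightarrow> 'e" where
  "scalar E a = (\<lambda>e \<in> carrier E. a \<odot>\<^bsub>E\<^esub> e)"

definition commutator :: "('r, 'x) ring_scheme \<Rightarrow> 'r \<Rightarrow> 'r \<Rightarrow> 'r" where
  "commutator R x y = x \<otimes>\<^bsub>R\<^esub> y \<ominus>\<^bsub>R\<^esub> y \<otimes>\<^bsub>R\<^esub> x"

definition Diff1 ::
  "('k, 'x) ring_scheme \<Rightarrow> ('k, 'a, 'y) module_scheme \<Rightarrow> ('a, 'e, 'z) module_scheme \<Rightarrow> ('e \<Rightarrow> 'e) set" where
  "Diff1 k A E = {g \<in> End_k k A E. \<forall>a \<in> carrier A. \<forall>b \<in> carrier A.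
     commutator (End_k_ring k A E) (commutator (End_k_ring k A E) g (scalar E a)) (scalar E b)
       = \<zero>\<^bsub>End_k_ring k A E\<^esub>}"

abbreviation fun_lmult :: "('a, 'e, 'z) module_scheme \<Rightarrow> 'a \<Rightarrow> ('e \<Rightarrow> 'e) \<Rightarrow> 'e \<Rightarrow> 'e" where
  "fun_lmult E c g \<equiv> compose (carrier E) (scalar E c) g"

abbreviation fun_rmult :: "('a, 'e, 'z) module_scheme \<Rightarrow> 'a \<Rightarrow> ('e \<Rightarrow> 'e) \<Rightarrow> 'e \<Rightarrow> 'e" where
  "fun_rmult E c g \<equiv> compose (carrier E) g (scalar E c)"

definition Diff1_module ::
  "('k, 'x) ring_scheme \<Rightarrow> ('k, 'a, 'y) module_scheme \<Rightarrow> ('a, 'e, 'z) module_scheme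
    \<Rightarrow> ('a tensor, 'e \<Rightarrow> 'e) module" where
  "Diff1_module k A E = bimodule (fun_ring E (Diff1 k A E)) (fun_lmult E) (fun_rmult E)"

definition End_A_module ::
  "('a, 'y) ring_scheme \<Rightarrow> ('a, 'e, 'z) module_scheme \<Rightarrow> ('a tensor, 'e \<Rightarrow> 'e) module" where
  "End_A_module A E = bimodule (fun_ring E (End_A A E)) (fun_lmult E) (fun_rmult E)"

locale L_connection = D_Lie_algebra k A f L + module A E
  for k :: "('k, 'x) ring_scheme" and A :: "('k, 'a, 'y) module_scheme"
    and f :: "('a \<Rightarrow> 'a) \<Rightarrow> ('a \<Rightarrow> 'a) \<Rightarrow> 'a" and L :: "('a, 'l, 'z) dlie_scheme"
    and E :: "('a, 'e, 'w) module_scheme" +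
  fixes \<rho> :: "'l \<Rightarrow> 'e \<Rightarrow> 'e"
  assumes rho_hom: "\<rho> \<in> mod_hom (tensor_ring k A) L (Diff1_module k A E)"

definition curvature where
  "curvature k A L E \<rho> u v =
     commutator (End_k_ring k A E) (\<rho> u) (\<rho> v) \<ominus>\<^bsub>End_k_ring k A E\<^esub> \<rho> (lie L u v)"

locale flat_L_connection = L_connection +
  assumes flat: "u \<in> carrier L \<Longrightarrow> v \<in> carrier L \<Longrightarrow>
    curvature k A L E \<rho> u v = \<zero>\<^bsub>End_k_ring k A E\<^esub>"

section \<open>The extension \<open>End(L, E)\<close>\<close>

text \<open>Sums and commutators in the bracket are formed in the ring \<open>End\<^sub>k(E)\<close>.\<close>

definition End_ext_lie where
  "End_ext_lie k A L E \<rho> = (\<lambda>(\<phi>, u) (\<psi>, v).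
     (commutator (End_k_ring k A E) \<phi> \<psi>
        \<oplus>\<^bsub>End_k_ring k A E\<^esub> commutator (End_k_ring k A E) (\<rho> u) \<psi>
        \<ominus>\<^bsub>End_k_ring k A E\<^esub> commutator (End_k_ring k A E) (\<rho> v) \<phi>
        \<oplus>\<^bsub>End_k_ring k A E\<^esub> curvature k A L E \<rho> u v,
      lie L u v))"

definition End_ext_module ::
  "('k, 'x) ring_scheme \<Rightarrow> ('k, 'a, 'y) module_scheme \<Rightarrow> ('a, 'l, 'z) dlie_scheme \<Rightarrow>
   ('a, 'e, 'w) module_scheme \<Rightarrow> ('a tensor, ('e \<Rightarrow> 'e) \<times> 'l) module" where
  "End_ext_module k A L E = bimodule
    \<lparr>carrier = End_A A E \<times> carrier L, mult = undefined, one = undefined,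
     zero = (\<lambda>e \<in> carrier E. \<zero>\<^bsub>E\<^esub>, \<zero>\<^bsub>L\<^esub>),
     add = (\<lambda>(\<phi>, u) (\<psi>, v). (\<lambda>e \<in> carrier E. \<phi> e \<oplus>\<^bsub>E\<^esub> \<psi> e, u \<oplus>\<^bsub>L\<^esub> v))\<rparr>
    (\<lambda>c (\<phi>, u). (fun_lmult E c \<phi>, tens k A c \<one>\<^bsub>A\<^esub> \<odot>\<^bsub>L\<^esub> u))
    (\<lambda>c (\<phi>, u). (fun_rmult E c \<phi>, tens k A \<one>\<^bsub>A\<^esub> c \<odot>\<^bsub>L\<^esub> u))"

definition End_ext ::
  "('k, 'x) ring_scheme \<Rightarrow> ('k, 'a, 'y) module_scheme \<Rightarrow> ('a, 'l, 'z) dlie_scheme \<Rightarrow>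
   ('a, 'e, 'w) module_scheme \<Rightarrow> ('l \<Rightarrow> 'e \<Rightarrow> 'e) \<Rightarrow> ('a, ('e \<Rightarrow> 'e) \<times> 'l) dlie" where
  "End_ext k A L E \<rho> = module.extend (End_ext_module k A L E)
    (dlie.fields (End_ext_lie k A L E \<rho>)
      (\<lambda>(\<phi>, u). alpha L u) (\<lambda>(\<phi>, u). anchor L u)
      (\<lambda>e \<in> carrier E. \<zero>\<^bsub>E\<^esub>, cent L))"

definition rho_shriek ::
  "('e, 'w) ring_scheme \<Rightarrow> ('l \<Rightarrow> 'e \<Rightarrow> 'e) \<Rightarrow> ('e \<Rightarrow> 'e) \<times> 'l \<Rightarrow> 'e \<Rightarrow> 'e" where
  "rho_shriek E \<rho> = (\<lambda>(\<phi>, u). \<lambda>e \<in> carrier E. \<phi> e \<oplus>\<^bsub>E\<^esub> \<rho> u e)"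

definition p_E :: "('e \<Rightarrow> 'e) \<times> 'l \<Rightarrow> 'l" where
  "p_E = (\<lambda>(\<phi>, u). u)"

end

theory Submission
  imports Defs
begin

text \<open>
  The map \<open>(\<phi>, u) \<mapsto> (\<phi> + \<rho>(u), u)\<close> embeds \<open>End(L, E)\<close> into \<open>End\<^sub>k(E) \<oplus> L\<close>, and it carries the
  bracket of the extension to the componentwise one. Its first component is \<open>\<rho>\<^sup>!\<close>, so flatness of
  \<open>\<rho>\<^sup>!\<close>, the Jacobi identity and the other axioms can be read off from the commutator of
  \<open>End\<^sub>k(E)\<close> and the bracket of \<open>L\<close>. Since \<open>\<rho>(D) = 1\<close>, the relation \<open>da \<cdot> u = \<pi>(u)(a) D\<close> gives
  \<open>[\<rho>(u), a] = \<pi>(u)(a)\<close>. Hence two such connections differ by \<open>A\<close>-linear maps, and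
  \<open>s(u) = (\<rho>'(u) - \<rho>(u), u)\<close> and \<open>\<rho>' = \<rho>\<^sup>! \<circ> s\<close> match sections with flat connections \<open>\<rho>'\<close>.
\<close>

text \<open>Much of the work lies below the Lie theory. The scalar action on
  \<open>bimodule G l r\<close> is computed on a representative picked by \<open>SOME\<close>, so
  not even additivity in the scalar is available until the choice is shown to be immaterial. This is
  proved once, for any two commuting actions of \<open>A\<close> that agree on \<open>k\<close>, and
  then serves for \<open>Diff1\<close>, \<open>End_A\<close> and the extension. Since pure tensors
  generate \<open>A \<otimes>\<^sub>k A\<close> additively, linearity of a map is afterwards tested
  on them alone. The embedding does not show by itself that the bracket stays in the extension: its
  first component has to be A-linear. That rests on each commutator of \<rho>(u) with an element of
  A being a scalar, so that bracketing with \<rho>(u) preserves A-linear maps, and on the anchor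
  being a Lie map, which makes the curvature A-linear. Annihilation by the square of I is checked on
  each summand: on the endomorphisms of E left and right multiplication coincide, and for L it is
  assumed.\<close>

lemma abelian_group_cong:
  assumes "abelian_group G" "carrier H = carrier G" "add H = add G" "zero H = zero G"
  shows "abelian_group H"
proof -
  interpret abelian_group G by fact
  show ?thesis
    by (rule abelian_groupI) (use assms(2-4) in \<open>auto simp: a_ac intro: l_neg\<close>)
qed

section \<open>Formal combinations of pairs\<close>

text \<open>The product of the integral monoid ring of \<open>A \<times> A\<close>. Written with
  \<open>fst\<close> and \<open>snd\<close> in place of the tuple patterns of
  \<open>formal_ring\<close>, so that linearity of \<open>frag_extend\<close> applies by
  rewriting.\<close>

definition formal_mult :: "('a, 'y) ring_scheme \<Rightarrow> 'a formal \<Rightarrow> 'a formal \<Rightarrow> 'a formal" where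
  "formal_mult A x y = frag_extend (\<lambda>p.
     frag_extend (\<lambda>q. frag_of (fst p \<otimes>\<^bsub>A\<^esub> fst q, snd p \<otimes>\<^bsub>A\<^esub> snd q)) y) x"

lemma frag_extend_diff_fun:
  "frag_extend (\<lambda>p. g p - h p) x = frag_extend g x - frag_extend h x"
  using subset_UNIV by (induction x rule: frag_induction) (auto simp: frag_extend_diff)

lemma formal_ring_simps [simp]:
  "carrier (formal_ring A) = {x. Poly_Mapping.keys x \<subseteq> carrier A \<times> carrier A}"
  "x \<otimes>\<^bsub>formal_ring A\<^esub> y = formal_mult A x y"
  "\<one>\<^bsub>formal_ring A\<^esub> = frag_of (\<one>\<^bsub>A\<^esub>, \<one>\<^bsub>A\<^esub>)"
  "\<zero>\<^bsub>formal_ring A\<^esub> = 0"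
  "x \<oplus>\<^bsub>formal_ring A\<^esub> y = x + y"
  by (simp_all add: formal_ring_def formal_mult_def case_prod_unfold)

lemma formal_mult_simps [simp]:
  "formal_mult A 0 y = 0"
  "formal_mult A x 0 = 0"
  "formal_mult A (x - x') y = formal_mult A x y - formal_mult A x' y"
  "formal_mult A x (y - y') = formal_mult A x y - formal_mult A x y'"
  "formal_mult A (frag_of (a, b)) (frag_of (c, d)) = frag_of (a \<otimes>\<^bsub>A\<^esub> c, b \<otimes>\<^bsub>A\<^esub> d)"
  by (simp_all add: formal_mult_def frag_extend_diff frag_extend_eq_0 frag_extend_diff_fun)

lemma formal_mult_add_left: "formal_mult A (x + x') y = formal_mult A x y + formal_mult A x' y"
  by (simp add: formal_mult_def frag_extend_add)

lemma keys_add_subset: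
  "Poly_Mapping.keys x \<subseteq> S \<Longrightarrow> Poly_Mapping.keys y \<subseteq> S \<Longrightarrow> Poly_Mapping.keys (x + y :: 'b \<Rightarrow>\<^sub>0 int) \<subseteq> S"
  using Poly_Mapping.keys_add[of x y] by blast

lemma keys_diff_subset:
  "Poly_Mapping.keys x \<subseteq> S \<Longrightarrow> Poly_Mapping.keys y \<subseteq> S \<Longrightarrow> Poly_Mapping.keys (x - y :: 'b \<Rightarrow>\<^sub>0 int) \<subseteq> S"
  using keys_diff[of x y] by blast

context cring
begin

text \<open>The pattern for this and the next facts: \<open>frag_induction\<close> builds every
  combination from single pairs by subtraction, and \<open>formal_mult\<close> respects differences
  in each argument, so only pairs have to be examined.\<close>

lemma keys_formal_mult:
  assumes "Poly_Mapping.keys x \<subseteq> carrier R \<times> carrier R" "Poly_Mapping.keys y \<subseteq> carrier R \<times> carrier R"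
  shows "Poly_Mapping.keys (formal_mult R x y) \<subseteq> carrier R \<times> carrier R"
  using assms(1)
proof (induction x rule: frag_induction)
  case (one p)
  then obtain a b where p: "p = (a, b)" "a \<in> carrier R" "b \<in> carrier R" by auto
  show ?case using assms(2)
    by (induction y rule: frag_induction) (simp_all add: p keys_diff_subset split_paired_all)
qed (simp_all add: keys_diff_subset)

lemma formal_mult_comm:
  assumes "Poly_Mapping.keys x \<subseteq> carrier R \<times> carrier R" "Poly_Mapping.keys y \<subseteq> carrier R \<times> carrier R"
  shows "formal_mult R x y = formal_mult R y x"
  using assms(1)
proof (induction x rule: frag_induction)
  case (one p)
  then obtain a b where p: "p = (a, b)" "a \<in> carrier R" "b \<in> carrier R" by auto
  show ?case using assms(2)
    by (induction y rule: frag_induction) (use p m_comm in auto)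
qed auto

lemma formal_mult_assoc:
  assumes "Poly_Mapping.keys x \<subseteq> carrier R \<times> carrier R" "Poly_Mapping.keys y \<subseteq> carrier R \<times> carrier R"
    "Poly_Mapping.keys z \<subseteq> carrier R \<times> carrier R"
  shows "formal_mult R (formal_mult R x y) z = formal_mult R x (formal_mult R y z)"
  using assms(1)
proof (induction x rule: frag_induction)
  case (one p)
  then obtain a b where p: "p = (a, b)" "a \<in> carrier R" "b \<in> carrier R" by auto
  show ?case using assms(2)
  proof (induction y rule: frag_induction)
    case (one q)
    then obtain c d where q: "q = (c, d)" "c \<in> carrier R" "d \<in> carrier R" by auto
    show ?case using assms(3)
      by (induction z rule: frag_induction) (use p q m_assoc in auto)
  qed auto
qed auto

lemma formal_mult_one:
  assumes "Poly_Mapping.keys x \<subseteq> carrier R \<times> carrier R"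
  shows "formal_mult R (frag_of (\<one>, \<one>)) x = x"
  using assms by (induction x rule: frag_induction) auto

lemma cring_formal_ring: "cring (formal_ring R)"
proof (rule cringI)
  show "abelian_group (formal_ring R)"
  proof (rule abelian_groupI)
    fix x assume "x \<in> carrier (formal_ring R)"
    then show "\<exists>y\<in>carrier (formal_ring R). y \<oplus>\<^bsub>formal_ring R\<^esub> x = \<zero>\<^bsub>formal_ring R\<^esub>"
      by (intro bexI[of _ "- x"]) auto
  qed (auto simp: add_ac dest!: subsetD[OF keys_add])
  show "comm_monoid (formal_ring R)"
    by (rule comm_monoidI)
      (auto simp: formal_mult_assoc formal_mult_one dest!: subsetD[OF keys_formal_mult, rotated 2] intro: formal_mult_comm)
qed (auto simp: formal_mult_add_left)

lemma formal_ring_a_inv: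
  assumes "x \<in> carrier (formal_ring R)"
  shows "\<ominus>\<^bsub>formal_ring R\<^esub> x = - x"
proof -
  interpret F: cring "formal_ring R" by (rule cring_formal_ring)
  show ?thesis
    using assms by (intro F.minus_equality) auto
qed

end

text \<open>The additive extension of \<open>g\<close> from pairs to formal combinations; it is the
  sum that \<open>tensor_lift\<close> forms once a representative is fixed.\<close>

definition frag_sum :: "('m, 'z) ring_scheme \<Rightarrow> ('a \<Rightarrow> 'a \<Rightarrow> 'm) \<Rightarrow> 'a formal \<Rightarrow> 'm" where
  "frag_sum M g x =
     (\<Oplus>\<^bsub>M\<^esub>p \<in> Poly_Mapping.keys x. add_pow M (Poly_Mapping.lookup x p) (g (fst p) (snd p)))"

context abelian_group
begin

lemma int_add_pow_0 [simp]: "add_pow G (0 :: int) x = \<zero>"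
  by (simp add: add_pow_def)

text \<open>Cancellation can make the support of a sum smaller than the union of the two supports.
  Padding with keys of coefficient 0 puts all three sums over one index set.\<close>

lemma frag_sum_superset:
  assumes "\<And>a b. a \<in> X \<Longrightarrow> b \<in> X \<Longrightarrow> g a b \<in> carrier G" "finite S" "Poly_Mapping.keys x \<subseteq> S" "S \<subseteq> X \<times> X"
  shows "frag_sum G g x = (\<Oplus>p \<in> S. add_pow G (Poly_Mapping.lookup x p) (g (fst p) (snd p)))"
  unfolding frag_sum_def
  by (rule add.finprod_mono_neutral_cong_left)
    (use assms in \<open>auto simp: in_keys_iff subset_iff\<close>)

lemma frag_sum_0 [simp]: "frag_sum G g 0 = \<zero>"
  by (simp add: frag_sum_def)

lemma frag_sum_of [simp]: "g a b \<in> carrier G \<Longrightarrow> frag_sum G g (frag_of (a, b)) = g a b"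
  by (simp add: frag_sum_def)

lemma frag_sum_closed:
  assumes "\<And>a b. a \<in> X \<Longrightarrow> b \<in> X \<Longrightarrow> g a b \<in> carrier G" "Poly_Mapping.keys x \<subseteq> X \<times> X"
  shows "frag_sum G g x \<in> carrier G"
  unfolding frag_sum_def
  by (rule finsum_closed) (use assms in \<open>auto simp: subset_iff\<close>)

lemma frag_sum_add:
  assumes g: "\<And>a b. a \<in> X \<Longrightarrow> b \<in> X \<Longrightarrow> g a b \<in> carrier G"
    and x: "Poly_Mapping.keys x \<subseteq> X \<times> X" and y: "Poly_Mapping.keys y \<subseteq> X \<times> X"
  shows "frag_sum G g (x + y) = frag_sum G g x \<oplus> frag_sum G g y"
proof -
  let ?S = "Poly_Mapping.keys x \<union> Poly_Mapping.keys y"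
  have S: "finite ?S" "?S \<subseteq> X \<times> X" "Poly_Mapping.keys (x + y) \<subseteq> ?S"
    using x y Poly_Mapping.keys_add[of x y] by auto
  have gS: "g (fst p) (snd p) \<in> carrier G" if "p \<in> ?S" for p
    using that S(2) g by force
  have "(\<Oplus>p \<in> ?S. add_pow G (Poly_Mapping.lookup (x + y) p) (g (fst p) (snd p)))
     = (\<Oplus>p \<in> ?S. add_pow G (Poly_Mapping.lookup x p) (g (fst p) (snd p))
         \<oplus> add_pow G (Poly_Mapping.lookup y p) (g (fst p) (snd p)))"
    by (rule finsum_cong')
      (use gS in \<open>auto simp: lookup_add add.int_pow_mult\<close>)
  also have "\<dots> = (\<Oplus>p \<in> ?S. add_pow G (Poly_Mapping.lookup x p) (g (fst p) (snd p)))
     \<oplus> (\<Oplus>p \<in> ?S. add_pow G (Poly_Mapping.lookup y p) (g (fst p) (snd p)))"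
    by (rule finsum_addf) (use gS in auto)
  finally show ?thesis
    using frag_sum_superset[where g = g and S = ?S and X = X] g S by simp
qed

lemma frag_sum_diff:
  assumes g: "\<And>a b. a \<in> X \<Longrightarrow> b \<in> X \<Longrightarrow> g a b \<in> carrier G"
    and x: "Poly_Mapping.keys x \<subseteq> X \<times> X" and y: "Poly_Mapping.keys y \<subseteq> X \<times> X"
  shows "frag_sum G g (x - y) = frag_sum G g x \<ominus> frag_sum G g y"
proof -
  have d: "Poly_Mapping.keys (x - y) \<subseteq> X \<times> X" using x y by (rule keys_diff_subset)
  have "frag_sum G g (x - y) \<oplus> frag_sum G g y = frag_sum G g x"
    using frag_sum_add[where g = g, OF g d y] by simp
  moreover note frag_sum_closed[where g = g, OF g y] frag_sum_closed[where g = g, OF g d]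
  ultimately show ?thesis
    by (simp add: minus_eq a_assoc r_neg flip: \<open>frag_sum G g (x - y) \<oplus> frag_sum G g y = frag_sum G g x\<close>)
qed

end

section \<open>The ring \<open>A \<otimes>\<^sub>k A\<close>\<close>

text \<open>Carries a module structure from a \<open>bimodule\<close> to the larger record that also
  holds a bracket, \<open>alpha\<close>, an anchor and a central element.\<close>

lemma module_cong:
  assumes "module T M" "carrier N = carrier M" "add N = add M" "zero N = zero M" "smult N = smult M"
  shows "module T N"
proof -
  interpret module T M by fact
  show ?thesis
    by (rule moduleI)
      (use assms R.is_cring abelian_group_cong[OF M.abelian_group_axioms, of N] in
        \<open>auto simp: smult_l_distr smult_r_distr smult_assoc1\<close>)
qed

context algebra
begin

abbreviation "tens_hom \<equiv> (+>\<^bsub>formal_ring M\<^esub>) (tensor_ideal R M)"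

lemma ideal_tensor_ideal: "ideal (tensor_ideal R M) (formal_ring M)"
  and tensor_rels_subset: "tensor_rels R M \<subseteq> tensor_ideal R M"
proof -
  interpret F: cring "formal_ring M" by (rule cring_formal_ring)
  have "tensor_rels R M \<subseteq> carrier (formal_ring M)"
    unfolding tensor_rels_def formal_ring_simps by (auto dest!: subsetD[OF keys_diff])
  then show "ideal (tensor_ideal R M) (formal_ring M)" "tensor_rels R M \<subseteq> tensor_ideal R M"
    unfolding tensor_ideal_def by (simp_all add: F.genideal_ideal F.genideal_self)
qed

lemma tens_hom_ring_hom: "ring_hom_cring (formal_ring M) (tensor_ring R M) tens_hom"
  unfolding tensor_ring_def
  by (rule ideal.rcos_ring_hom_cring[OF ideal_tensor_ideal cring_formal_ring])

lemma cring_tensor_ring: "cring (tensor_ring R M)"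
  using tens_hom_ring_hom by (rule ring_hom_cring.axioms)

lemma carrier_tensor_ring: "carrier (tensor_ring R M) = tens_hom ` carrier (formal_ring M)"
  by (auto simp: tensor_ring_def FactRing_def A_RCOSETS_def')

lemma tens_hom_eqI:
  assumes "x \<in> carrier (formal_ring M)" "y \<in> carrier (formal_ring M)" "x - y \<in> tensor_ideal R M"
  shows "tens_hom x = tens_hom y"
proof -
  interpret H: ring_hom_cring "formal_ring M" "tensor_ring R M" tens_hom by (rule tens_hom_ring_hom)
  interpret I: ideal "tensor_ideal R M" "formal_ring M" by (rule ideal_tensor_ideal)
  have d: "x - y \<in> carrier (formal_ring M)"
    using assms(3) by (rule I.Icarr)
  have "tens_hom (x - y) = \<zero>\<^bsub>tensor_ring R M\<^esub>"
    using assms(3) by (simp add: I.a_rcos_const tensor_ring_def FactRing_def)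
  then have "tens_hom (y \<oplus>\<^bsub>formal_ring M\<^esub> (x - y)) = tens_hom y"
    using d assms(2) by (simp only: H.hom_add H.hom_closed H.S.r_zero)
  then show ?thesis by simp
qed

lemma tens_hom_of: "tens_hom (frag_of (a, b)) = tens R M a b"
  by (simp add: tens_def)

lemma tens_closed [simp]:
  "a \<in> carrier M \<Longrightarrow> b \<in> carrier M \<Longrightarrow> tens R M a b \<in> carrier (tensor_ring R M)"
  unfolding carrier_tensor_ring tens_def by auto

lemma tens_one: "tens R M \<one>\<^bsub>M\<^esub> \<one>\<^bsub>M\<^esub> = \<one>\<^bsub>tensor_ring R M\<^esub>"
proof -
  interpret H: ring_hom_cring "formal_ring M" "tensor_ring R M" tens_hom by (rule tens_hom_ring_hom)
  show ?thesis using H.hom_one by (simp add: tens_def)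
qed

lemma tens_mult:
  assumes "a \<in> carrier M" "b \<in> carrier M" "c \<in> carrier M" "d \<in> carrier M"
  shows "tens R M a b \<otimes>\<^bsub>tensor_ring R M\<^esub> tens R M c d = tens R M (a \<otimes>\<^bsub>M\<^esub> c) (b \<otimes>\<^bsub>M\<^esub> d)"
proof -
  interpret H: ring_hom_cring "formal_ring M" "tensor_ring R M" tens_hom by (rule tens_hom_ring_hom)
  show ?thesis using H.hom_mult[of "frag_of (a, b)" "frag_of (c, d)"] assms by (simp add: tens_def)
qed

lemma tensor_relsI:
  assumes "a \<in> carrier M" "a' \<in> carrier M" "b \<in> carrier M" "b' \<in> carrier M" "s \<in> carrier R"
  shows "frag_of (a \<oplus>\<^bsub>M\<^esub> a', b) - frag_of (a, b) - frag_of (a', b) \<in> tensor_rels R M"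
    and "frag_of (a, b \<oplus>\<^bsub>M\<^esub> b') - frag_of (a, b) - frag_of (a, b') \<in> tensor_rels R M"
    and "frag_of (s \<odot>\<^bsub>M\<^esub> a, b) - frag_of (a, s \<odot>\<^bsub>M\<^esub> b) \<in> tensor_rels R M"
  unfolding tensor_rels_def using assms by blast+

text \<open>Both additivity relations have the shape \<open>p - q - q'\<close>, so one argument
  gives additivity of \<open>tens\<close> in either slot.\<close>

lemma tens_rel_add:
  assumes "frag_of p - frag_of q - frag_of q' \<in> tensor_rels R M"
    "p \<in> carrier M \<times> carrier M" "q \<in> carrier M \<times> carrier M" "q' \<in> carrier M \<times> carrier M"
  shows "tens_hom (frag_of p) = tens_hom (frag_of q) \<oplus>\<^bsub>tensor_ring R M\<^esub> tens_hom (frag_of q')"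
proof -
  interpret H: ring_hom_cring "formal_ring M" "tensor_ring R M" tens_hom by (rule tens_hom_ring_hom)
  have "tens_hom (frag_of p) = tens_hom (frag_of q \<oplus>\<^bsub>formal_ring M\<^esub> frag_of q')"
    using assms tensor_rels_subset
    by (intro tens_hom_eqI) (auto simp: diff_diff_eq intro!: keys_add_subset dest!: subsetD[OF keys_add])
  also have "\<dots> = tens_hom (frag_of q) \<oplus>\<^bsub>tensor_ring R M\<^esub> tens_hom (frag_of q')"
    using assms by (intro H.hom_add) auto
  finally show ?thesis .
qed

lemma tens_add_left:
  assumes "a \<in> carrier M" "a' \<in> carrier M" "b \<in> carrier M"
  shows "tens R M (a \<oplus>\<^bsub>M\<^esub> a') b = tens R M a b \<oplus>\<^bsub>tensor_ring R M\<^esub> tens R M a' b"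
  unfolding tens_def by (rule tens_rel_add) (use assms in \<open>auto intro: tensor_relsI\<close>)

lemma tens_add_right:
  assumes "a \<in> carrier M" "b \<in> carrier M" "b' \<in> carrier M"
  shows "tens R M a (b \<oplus>\<^bsub>M\<^esub> b') = tens R M a b \<oplus>\<^bsub>tensor_ring R M\<^esub> tens R M a b'"
  unfolding tens_def by (rule tens_rel_add) (use assms in \<open>auto intro: tensor_relsI\<close>)

lemma tens_balanced:
  assumes "s \<in> carrier R" "a \<in> carrier M" "b \<in> carrier M"
  shows "tens R M (s \<odot>\<^bsub>M\<^esub> a) b = tens R M a (s \<odot>\<^bsub>M\<^esub> b)"
  unfolding tens_def
  by (rule tens_hom_eqI) (use assms tensor_rels_subset in \<open>auto intro: tensor_relsI\<close>)

text \<open>Pure tensors generate the additive group: a coset has a representative in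
  \<open>formal_ring\<close>, and induction on that representative passes through the quotient
  map.\<close>

lemma tensor_induct [consumes 1, case_names zero tens diff]:
  assumes t: "t \<in> carrier (tensor_ring R M)"
    and zero: "P \<zero>\<^bsub>tensor_ring R M\<^esub>"
    and tens: "\<And>a b. a \<in> carrier M \<Longrightarrow> b \<in> carrier M \<Longrightarrow> P (tens R M a b)"
    and diff: "\<And>s t. s \<in> carrier (tensor_ring R M) \<Longrightarrow> t \<in> carrier (tensor_ring R M) \<Longrightarrow>
      P s \<Longrightarrow> P t \<Longrightarrow> P (s \<ominus>\<^bsub>tensor_ring R M\<^esub> t)"
  shows "P t"
proof -
  interpret H: ring_hom_cring "formal_ring M" "tensor_ring R M" tens_hom by (rule tens_hom_ring_hom)
  obtain x where x: "Poly_Mapping.keys x \<subseteq> carrier M \<times> carrier M" "t = tens_hom x"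
    using t unfolding carrier_tensor_ring by auto
  have "x \<in> carrier (formal_ring M) \<and> P (tens_hom x)"
    using x(1)
  proof (induction x rule: frag_induction)
    case zero
    then show ?case using assms(2) H.hom_zero by simp
  next
    case (one p)
    then show ?case using tens by (auto simp: tens_def)
  next
    case (diff x y)
    then have xy: "x \<in> carrier (formal_ring M)" "y \<in> carrier (formal_ring M)" by auto
    have "x \<ominus>\<^bsub>formal_ring M\<^esub> y = x - y"
      unfolding a_minus_def using xy formal_ring_a_inv[of y] by simp
    then have "tens_hom (x - y) = tens_hom x \<ominus>\<^bsub>tensor_ring R M\<^esub> tens_hom y"
      using xy by (metis H.hom_a_inv H.hom_add a_minus_def H.R.a_inv_closed)
    then show ?case
      using diff xy assms(4)[of "tens_hom x" "tens_hom y"] H.hom_closed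
      by (auto dest!: subsetD[OF keys_diff])
  qed
  then show ?thesis using x(2) by simp
qed

text \<open>Both sides of the linearity law are additive in the scalar, hence agree everywhere once
  they agree on pure tensors.\<close>

lemma mod_homI:
  assumes "module (tensor_ring R M) X" "module (tensor_ring R M) Y"
    and closed: "\<And>x. x \<in> carrier X \<Longrightarrow> h x \<in> carrier Y"
    and add: "\<And>x y. x \<in> carrier X \<Longrightarrow> y \<in> carrier X \<Longrightarrow> h (x \<oplus>\<^bsub>X\<^esub> y) = h x \<oplus>\<^bsub>Y\<^esub> h y"
    and tens: "\<And>a b x. a \<in> carrier M \<Longrightarrow> b \<in> carrier M \<Longrightarrow> x \<in> carrier X \<Longrightarrow>
      h (tens R M a b \<odot>\<^bsub>X\<^esub> x) = tens R M a b \<odot>\<^bsub>Y\<^esub> h x"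
  shows "h \<in> mod_hom (tensor_ring R M) X Y"
proof -
  interpret X: module "tensor_ring R M" X by fact
  interpret Y: module "tensor_ring R M" Y by fact
  interpret h: abelian_group_hom X Y h
    by (rule abelian_group_homI)
      (use closed add X.M.abelian_group_axioms Y.M.abelian_group_axioms in
        \<open>auto intro!: group_hom.intro group_hom_axioms.intro X.M.a_group Y.M.a_group simp: hom_def\<close>)
  have "h (t \<odot>\<^bsub>X\<^esub> x) = t \<odot>\<^bsub>Y\<^esub> h x"
    if "t \<in> carrier (tensor_ring R M)" and x: "x \<in> carrier X" for t x
    using that(1)
    by (induction t rule: tensor_induct)
      (use x closed tens in \<open>simp_all add: X.minus_eq Y.minus_eq X.R.minus_eq X.smult_l_distr Y.smult_l_distr
        X.smult_l_minus Y.smult_l_minus\<close>)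
  then show ?thesis
    unfolding mod_hom_def using closed add by auto
qed

end

section \<open>Modules over \<open>A \<otimes>\<^sub>k A\<close> from commuting actions\<close>

lemma (in abelian_group) add_diff_diff:
  assumes "x \<in> carrier G" "y \<in> carrier G"
  shows "x \<oplus> y \<ominus> x \<ominus> y = \<zero>"
  using assms by (simp add: a_comm[of x y] minus_eq a_assoc r_neg1 r_neg)

lemma (in abelian_group) diff_self: "x \<in> carrier G \<Longrightarrow> x \<ominus> x = \<zero>"
  by (simp add: minus_eq r_neg)

text \<open>These conditions make \<open>l a (r b m)\<close> biadditive and
  \<open>k\<close>-balanced in \<open>a\<close> and \<open>b\<close>, and multiplicative, so that it
  induces an action of the tensor ring. \<open>G\<close> may be any ring scheme, which lets a module
  or \<open>A\<close> itself take its place.\<close>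

locale balanced_bimodule = alg: algebra k A + G: abelian_group G
  for k :: "('k, 'x) ring_scheme" and A :: "('k, 'a, 'y) module_scheme" and G :: "('m, 'z) ring_scheme" +
  fixes l r :: "'a \<Rightarrow> 'm \<Rightarrow> 'm"
  assumes l_closed: "a \<in> carrier A \<Longrightarrow> m \<in> carrier G \<Longrightarrow> l a m \<in> carrier G"
    and r_closed: "a \<in> carrier A \<Longrightarrow> m \<in> carrier G \<Longrightarrow> r a m \<in> carrier G"
    and l_add: "a \<in> carrier A \<Longrightarrow> b \<in> carrier A \<Longrightarrow> m \<in> carrier G \<Longrightarrow> l (a \<oplus>\<^bsub>A\<^esub> b) m = l a m \<oplus>\<^bsub>G\<^esub> l b m"
    and r_add: "a \<in> carrier A \<Longrightarrow> b \<in> carrier A \<Longrightarrow> m \<in> carrier G \<Longrightarrow> r (a \<oplus>\<^bsub>A\<^esub> b) m = r a m \<oplus>\<^bsub>G\<^esub> r b m"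
    and l_add_right: "a \<in> carrier A \<Longrightarrow> m \<in> carrier G \<Longrightarrow> n \<in> carrier G \<Longrightarrow> l a (m \<oplus>\<^bsub>G\<^esub> n) = l a m \<oplus>\<^bsub>G\<^esub> l a n"
    and r_add_right: "a \<in> carrier A \<Longrightarrow> m \<in> carrier G \<Longrightarrow> n \<in> carrier G \<Longrightarrow> r a (m \<oplus>\<^bsub>G\<^esub> n) = r a m \<oplus>\<^bsub>G\<^esub> r a n"
    and l_mult: "a \<in> carrier A \<Longrightarrow> b \<in> carrier A \<Longrightarrow> m \<in> carrier G \<Longrightarrow> l (a \<otimes>\<^bsub>A\<^esub> b) m = l a (l b m)"
    and r_mult: "a \<in> carrier A \<Longrightarrow> b \<in> carrier A \<Longrightarrow> m \<in> carrier G \<Longrightarrow> r (a \<otimes>\<^bsub>A\<^esub> b) m = r a (r b m)"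
    and l_one: "m \<in> carrier G \<Longrightarrow> l \<one>\<^bsub>A\<^esub> m = m"
    and r_one: "m \<in> carrier G \<Longrightarrow> r \<one>\<^bsub>A\<^esub> m = m"
    and l_r: "a \<in> carrier A \<Longrightarrow> b \<in> carrier A \<Longrightarrow> m \<in> carrier G \<Longrightarrow> l a (r b m) = r b (l a m)"
    and scalars: "s \<in> carrier k \<Longrightarrow> m \<in> carrier G \<Longrightarrow> l (s \<odot>\<^bsub>A\<^esub> \<one>\<^bsub>A\<^esub>) m = r (s \<odot>\<^bsub>A\<^esub> \<one>\<^bsub>A\<^esub>) m"
begin

text \<open>Multiplication by \<open>s\<close> is multiplication by the element
  \<open>s \<odot> \<one>\<close> of \<open>A\<close>, and on such elements the two actions
  agree.\<close>

lemma balanced: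
  assumes "s \<in> carrier k" "a \<in> carrier A" "b \<in> carrier A" "m \<in> carrier G"
  shows "l (s \<odot>\<^bsub>A\<^esub> a) (r b m) = l a (r (s \<odot>\<^bsub>A\<^esub> b) m)"
proof -
  have s: "s \<odot>\<^bsub>A\<^esub> \<one>\<^bsub>A\<^esub> \<in> carrier A" using assms by auto
  have eq: "s \<odot>\<^bsub>A\<^esub> c = (s \<odot>\<^bsub>A\<^esub> \<one>\<^bsub>A\<^esub>) \<otimes>\<^bsub>A\<^esub> c" if "c \<in> carrier A" for c
    using assms(1) that alg.smult_assoc2[of s "\<one>\<^bsub>A\<^esub>" c] by simp
  have "l (s \<odot>\<^bsub>A\<^esub> a) (r b m) = l (a \<otimes>\<^bsub>A\<^esub> (s \<odot>\<^bsub>A\<^esub> \<one>\<^bsub>A\<^esub>)) (r b m)"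
    using eq[of a] alg.m_comm[of "s \<odot>\<^bsub>A\<^esub> \<one>\<^bsub>A\<^esub>" a] assms s by simp
  also have "\<dots> = l a (r (s \<odot>\<^bsub>A\<^esub> \<one>\<^bsub>A\<^esub>) (r b m))"
    using assms s by (simp add: l_mult scalars r_closed)
  also have "\<dots> = l a (r (s \<odot>\<^bsub>A\<^esub> b) m)"
    using assms s by (simp add: eq[of b] r_mult)
  finally show ?thesis .
qed

text \<open>The action before passing to the quotient. It involves no choice, so the module laws are
  proved for it and transferred afterwards.\<close>

definition act :: "'a formal \<Rightarrow> 'm \<Rightarrow> 'm" where
  "act x m = frag_sum G (\<lambda>a b. l a (r b m)) x"

lemma act_closed:
  "Poly_Mapping.keys x \<subseteq> carrier A \<times> carrier A \<Longrightarrow> m \<in> carrier G \<Longrightarrow> act x m \<in> carrier G"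
  unfolding act_def by (rule G.frag_sum_closed) (simp_all add: l_closed r_closed)

lemma act_0: "act 0 m = \<zero>\<^bsub>G\<^esub>"
  by (simp add: act_def)

lemma act_of:
  "a \<in> carrier A \<Longrightarrow> b \<in> carrier A \<Longrightarrow> m \<in> carrier G \<Longrightarrow> act (frag_of (a, b)) m = l a (r b m)"
  by (simp add: act_def l_closed r_closed)

lemma act_diff:
  assumes "Poly_Mapping.keys x \<subseteq> carrier A \<times> carrier A" "Poly_Mapping.keys y \<subseteq> carrier A \<times> carrier A" "m \<in> carrier G"
  shows "act (x - y) m = act x m \<ominus>\<^bsub>G\<^esub> act y m"
  unfolding act_def by (rule G.frag_sum_diff[where X = "carrier A"]) (use assms in \<open>simp_all add: l_closed r_closed\<close>)

lemma act_add:
  assumes "Poly_Mapping.keys x \<subseteq> carrier A \<times> carrier A" "Poly_Mapping.keys y \<subseteq> carrier A \<times> carrier A" "m \<in> carrier G"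
  shows "act (x + y) m = act x m \<oplus>\<^bsub>G\<^esub> act y m"
  unfolding act_def by (rule G.frag_sum_add[where X = "carrier A"]) (use assms in \<open>simp_all add: l_closed r_closed\<close>)

text \<open>Strengthens \<open>frag_induction\<close>: the difference case also knows that both
  parts are supported on pairs from \<open>A\<close>, as the laws for \<open>act\<close>
  require.\<close>

lemma formal_induct [consumes 1, case_names zero tens diff]:
  assumes "Poly_Mapping.keys x \<subseteq> carrier A \<times> carrier A"
    and "P 0"
    and "\<And>a b. a \<in> carrier A \<Longrightarrow> b \<in> carrier A \<Longrightarrow> P (frag_of (a, b))"
    and "\<And>x y. Poly_Mapping.keys x \<subseteq> carrier A \<times> carrier A \<Longrightarrow> Poly_Mapping.keys y \<subseteq> carrier A \<times> carrier A \<Longrightarrow>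
      P x \<Longrightarrow> P y \<Longrightarrow> P (x - y)"
  shows "P x"
proof -
  have "Poly_Mapping.keys x \<subseteq> carrier A \<times> carrier A \<and> P x"
    using assms(1)
    by (induction x rule: frag_induction) (use assms(2-) in \<open>auto simp: keys_diff_subset\<close>)
  then show ?thesis ..
qed

lemma act_add_right:
  assumes "Poly_Mapping.keys x \<subseteq> carrier A \<times> carrier A" and m: "m \<in> carrier G" and n: "n \<in> carrier G"
  shows "act x (m \<oplus>\<^bsub>G\<^esub> n) = act x m \<oplus>\<^bsub>G\<^esub> act x n"
  using assms(1)
proof (induction x rule: formal_induct)
  case (diff x y)
  then show ?case
    using m n act_closed[of x] act_closed[of y]
    by (simp add: act_diff G.minus_eq G.minus_add G.a_ac)
qed (use m n in \<open>simp_all add: act_0 act_of l_add_right r_add_right l_closed r_closed\<close>)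

lemma act_right_zero:
  assumes "Poly_Mapping.keys x \<subseteq> carrier A \<times> carrier A"
  shows "act x \<zero>\<^bsub>G\<^esub> = \<zero>\<^bsub>G\<^esub>"
  using act_add_right[OF assms, of "\<zero>\<^bsub>G\<^esub>" "\<zero>\<^bsub>G\<^esub>"] act_closed[OF assms, of "\<zero>\<^bsub>G\<^esub>"] by simp

lemma act_right_diff:
  assumes x: "Poly_Mapping.keys x \<subseteq> carrier A \<times> carrier A" and m: "m \<in> carrier G" and n: "n \<in> carrier G"
  shows "act x (m \<ominus>\<^bsub>G\<^esub> n) = act x m \<ominus>\<^bsub>G\<^esub> act x n"
proof -
  have "act x m = act x (m \<ominus>\<^bsub>G\<^esub> n) \<oplus>\<^bsub>G\<^esub> act x n"
    using m n by (simp add: G.minus_eq G.a_assoc G.l_neg flip: act_add_right[OF x])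
  then show ?thesis
    using act_closed[OF x] m n by (simp add: G.minus_eq G.a_assoc G.r_neg)
qed

text \<open>On single pairs the claim is that \<open>r b\<close> and \<open>l c\<close> may be
  interchanged, which is \<open>l_r\<close>; additivity in each combination does the rest.\<close>

lemma act_mult:
  assumes x: "Poly_Mapping.keys x \<subseteq> carrier A \<times> carrier A" and y: "Poly_Mapping.keys y \<subseteq> carrier A \<times> carrier A"
    and m: "m \<in> carrier G"
  shows "act (formal_mult A x y) m = act x (act y m)"
  using x
proof (induction x rule: formal_induct)
  case zero
  then show ?case by (simp add: act_0)
next
  case (tens a b)
  have ab: "Poly_Mapping.keys (frag_of (a, b)) \<subseteq> carrier A \<times> carrier A"
    using tens by simp
  show ?case using y
  proof (induction y rule: formal_induct)
    case zero
    then show ?case using act_right_zero[OF ab] by (simp add: act_0)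
  next
    case (tens c d)
    then show ?case
      using \<open>a \<in> carrier A\<close> \<open>b \<in> carrier A\<close> m by (simp add: act_of l_mult r_mult l_r l_closed r_closed)
  next
    case (diff y z)
    then show ?case
      using m alg.keys_formal_mult[OF ab]
      by (simp add: act_diff act_right_diff[OF ab] act_closed)
  qed
next
  case (diff x z)
  then show ?case using m y by (simp add: act_diff act_closed alg.keys_formal_mult)
qed

text \<open>The formal combinations that annihilate \<open>G\<close> form an ideal, so it suffices to check the generators.\<close>

lemma act_tensor_ideal:
  assumes "x \<in> tensor_ideal k A" and m: "m \<in> carrier G"
  shows "act x m = \<zero>\<^bsub>G\<^esub>"
proof -
  interpret F: cring "formal_ring A" by (rule alg.cring_formal_ring)
  define N where "N = {x \<in> carrier (formal_ring A). \<forall>m \<in> carrier G. act x m = \<zero>\<^bsub>G\<^esub>}"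
  have "ideal N (formal_ring A)"
  proof (rule idealI)
    show "ring (formal_ring A)" by (rule F.ring_axioms)
    have "- x \<in> N" if "x \<in> N" for x
    proof -
      have "act (0 - x) m = \<zero>\<^bsub>G\<^esub>" if "m \<in> carrier G" for m
        using \<open>x \<in> N\<close> that act_diff[of 0 x m] by (simp add: N_def act_0 G.minus_eq)
      then show ?thesis using \<open>x \<in> N\<close> by (simp add: N_def)
    qed
    moreover have "x + y \<in> N" if "x \<in> N" "y \<in> N" for x y
      using that by (auto simp: N_def act_add intro!: keys_add_subset dest!: subsetD[OF keys_add])
    ultimately show "subgroup N (add_monoid (formal_ring A))"
      by (intro F.add.subgroupI) (auto simp: N_def act_0 alg.formal_ring_a_inv)
    show left: "x \<otimes>\<^bsub>formal_ring A\<^esub> y \<in> N" if "y \<in> N" "x \<in> carrier (formal_ring A)" for x y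
      using that alg.keys_formal_mult[of x y] by (simp add: N_def act_mult act_right_zero)
    show "y \<otimes>\<^bsub>formal_ring A\<^esub> x \<in> N" if "y \<in> N" "x \<in> carrier (formal_ring A)" for x y
      using left[OF that] that F.m_comm[of y x] by (simp add: N_def)
  qed
  moreover have "tensor_rels k A \<subseteq> N"
  proof
    fix z assume "z \<in> tensor_rels k A"
    then consider
        (left) a a' b where "z = frag_of (a \<oplus>\<^bsub>A\<^esub> a', b) - frag_of (a, b) - frag_of (a', b)"
          "a \<in> carrier A" "a' \<in> carrier A" "b \<in> carrier A"
      | (right) a b b' where "z = frag_of (a, b \<oplus>\<^bsub>A\<^esub> b') - frag_of (a, b) - frag_of (a, b')"
          "a \<in> carrier A" "b \<in> carrier A" "b' \<in> carrier A"
      | (scal) s a b where "z = frag_of (s \<odot>\<^bsub>A\<^esub> a, b) - frag_of (a, s \<odot>\<^bsub>A\<^esub> b)"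
          "s \<in> carrier k" "a \<in> carrier A" "b \<in> carrier A"
      unfolding tensor_rels_def by blast
    then show "z \<in> N"
      by cases (simp_all add: N_def keys_diff_subset act_diff act_of l_add r_add l_add_right
        balanced l_closed r_closed G.add_diff_diff G.diff_self)
  qed
  ultimately have "tensor_ideal k A \<subseteq> N"
    unfolding tensor_ideal_def by (rule F.genideal_minimal)
  with assms show ?thesis by (auto simp: N_def)
qed

text \<open>The chosen representative differs from \<open>x\<close> by an element of
  \<open>tensor_ideal\<close>, which acts as zero.\<close>

lemma tensor_lift_act:
  assumes x: "x \<in> carrier (formal_ring A)" and m: "m \<in> carrier G"
  shows "tensor_lift G (\<lambda>a b. l a (r b m)) (alg.tens_hom x) = act x m"
proof -
  interpret I: ideal "tensor_ideal k A" "formal_ring A" by (rule alg.ideal_tensor_ideal)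
  define y where "y = (SOME y. y \<in> alg.tens_hom x)"
  have "y \<in> alg.tens_hom x"
    unfolding y_def by (rule someI[of _ x]) (rule I.a_rcos_self[OF x])
  then obtain i where i: "i \<in> tensor_ideal k A" "y = i + x"
    by (auto simp: a_r_coset_def')
  have "tensor_lift G (\<lambda>a b. l a (r b m)) (alg.tens_hom x) = act y m"
    by (simp add: tensor_lift_def act_def frag_sum_def y_def Let_def)
  also have "\<dots> = act x m"
    using i x m I.Icarr[of i] act_closed[of x m] by (simp add: act_add act_tensor_ideal)
  finally show ?thesis .
qed

end

section \<open>The module over the tensor ring defined by two balanced actions\<close>

lemma bimodule_simps [simp]:
  "carrier (bimodule G l r) = carrier G" "add (bimodule G l r) = add G" "zero (bimodule G l r) = zero G"
  by (simp_all add: bimodule_def)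

context
  fixes k :: "('k, 'x) ring_scheme" and A :: "('k, 'a, 'y) module_scheme" and G :: "'m ring" and l r
  assumes "balanced_bimodule k A G l r"
begin

interpretation balanced_bimodule k A G l r by fact

text \<open>Any representative computes the scalar action, so the laws of \<open>act\<close> become
  module laws. The context takes \<open>G\<close> to be a plain \<open>ring\<close>, the type that
  \<open>bimodule\<close> expects.\<close>

lemma smult_bimodule:
  "x \<in> carrier (formal_ring A) \<Longrightarrow> m \<in> carrier G \<Longrightarrow> alg.tens_hom x \<odot>\<^bsub>bimodule G l r\<^esub> m = act x m"
  by (simp add: bimodule_def tensor_lift_act)

lemma smult_bimodule_tens:
  "a \<in> carrier A \<Longrightarrow> b \<in> carrier A \<Longrightarrow> m \<in> carrier G \<Longrightarrow> tens k A a b \<odot>\<^bsub>bimodule G l r\<^esub> m = l a (r b m)"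
  using smult_bimodule[of "frag_of (a, b)" m] by (simp add: alg.tens_hom_of act_of)

lemma module_bimodule: "module (tensor_ring k A) (bimodule G l r)"
proof (rule moduleI)
  interpret H: ring_hom_cring "formal_ring A" "tensor_ring k A" alg.tens_hom by (rule alg.tens_hom_ring_hom)
  show "cring (tensor_ring k A)" by (rule alg.cring_tensor_ring)
  show "abelian_group (bimodule G l r)"
    by (rule abelian_group_cong[OF G.abelian_group_axioms]) simp_all
  fix m assume m: "m \<in> carrier (bimodule G l r)"
  show "\<one>\<^bsub>tensor_ring k A\<^esub> \<odot>\<^bsub>bimodule G l r\<^esub> m = m"
    using smult_bimodule_tens[of "\<one>\<^bsub>A\<^esub>" "\<one>\<^bsub>A\<^esub>" m] m by (simp add: alg.tens_one l_one r_one)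
  fix s assume "s \<in> carrier (tensor_ring k A)"
  then obtain x where x: "x \<in> carrier (formal_ring A)" "s = alg.tens_hom x"
    unfolding alg.carrier_tensor_ring by auto
  show "s \<odot>\<^bsub>bimodule G l r\<^esub> m \<in> carrier (bimodule G l r)"
    using m x act_closed by (simp add: smult_bimodule)
  fix n assume n: "n \<in> carrier (bimodule G l r)"
  show "s \<odot>\<^bsub>bimodule G l r\<^esub> (m \<oplus>\<^bsub>bimodule G l r\<^esub> n) =
      s \<odot>\<^bsub>bimodule G l r\<^esub> m \<oplus>\<^bsub>bimodule G l r\<^esub> s \<odot>\<^bsub>bimodule G l r\<^esub> n"
    using m n x by (simp add: smult_bimodule act_add_right)
next
  interpret H: ring_hom_cring "formal_ring A" "tensor_ring k A" alg.tens_hom by (rule alg.tens_hom_ring_hom)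
  fix s t m assume "s \<in> carrier (tensor_ring k A)" "t \<in> carrier (tensor_ring k A)"
    and "m \<in> carrier (bimodule G l r)"
  then obtain x y where xy: "x \<in> carrier (formal_ring A)" "s = alg.tens_hom x"
     "y \<in> carrier (formal_ring A)" "t = alg.tens_hom y" and m: "m \<in> carrier G"
    unfolding alg.carrier_tensor_ring by auto
  have "s \<oplus>\<^bsub>tensor_ring k A\<^esub> t = alg.tens_hom (x + y)"
    using H.hom_add[of x y] xy by simp
  moreover have "s \<otimes>\<^bsub>tensor_ring k A\<^esub> t = alg.tens_hom (formal_mult A x y)"
    using H.hom_mult[of x y] xy by simp
  moreover have "x + y \<in> carrier (formal_ring A)" "formal_mult A x y \<in> carrier (formal_ring A)"
    using xy keys_add_subset[of x] alg.keys_formal_mult[of x y] by auto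
  ultimately show "(s \<oplus>\<^bsub>tensor_ring k A\<^esub> t) \<odot>\<^bsub>bimodule G l r\<^esub> m =
      s \<odot>\<^bsub>bimodule G l r\<^esub> m \<oplus>\<^bsub>bimodule G l r\<^esub> t \<odot>\<^bsub>bimodule G l r\<^esub> m"
    "(s \<otimes>\<^bsub>tensor_ring k A\<^esub> t) \<odot>\<^bsub>bimodule G l r\<^esub> m = s \<odot>\<^bsub>bimodule G l r\<^esub> (t \<odot>\<^bsub>bimodule G l r\<^esub> m)"
    using xy m by (simp_all add: smult_bimodule act_add act_mult act_closed)
qed

text \<open>An element \<open>t\<close> acts on a symmetric bimodule through its image in \<open>A\<close>, so already \<open>I\<close> annihilates it.\<close>

lemma P_module_symmetric:
  assumes sym: "\<And>a m. a \<in> carrier A \<Longrightarrow> m \<in> carrier G \<Longrightarrow> r a m = l a m"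
  shows "P_module k A (bimodule G l r)"
proof -
  interpret B: module "tensor_ring k A" "bimodule G l r" by (rule module_bimodule)
  interpret I: ideal "tensor_ideal k A" "formal_ring A" by (rule alg.ideal_tensor_ideal)
  \<comment> \<open>\<open>A\<close> acts on itself from both sides; applying this action to
    \<open>\<one>\<close> computes the multiplication map on formal combinations.\<close>
  interpret AA: balanced_bimodule k A A "(\<otimes>\<^bsub>A\<^esub>)" "(\<otimes>\<^bsub>A\<^esub>)"
    by unfold_locales (auto simp: alg.l_distr alg.r_distr alg.m_ac)
  have l_zero: "l \<zero>\<^bsub>A\<^esub> m = \<zero>\<^bsub>G\<^esub>" if "m \<in> carrier G" for m
    using l_add[of "\<zero>\<^bsub>A\<^esub>" "\<zero>\<^bsub>A\<^esub>" m] l_closed[of "\<zero>\<^bsub>A\<^esub>" m] that by simp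
  have l_diff: "l (a \<ominus>\<^bsub>A\<^esub> b) m = l a m \<ominus>\<^bsub>G\<^esub> l b m"
    if "a \<in> carrier A" "b \<in> carrier A" "m \<in> carrier G" for a b m
  proof -
    have "l a m = l (a \<ominus>\<^bsub>A\<^esub> b) m \<oplus>\<^bsub>G\<^esub> l b m"
      using that by (simp add: alg.minus_eq alg.a_assoc alg.l_neg flip: l_add)
    then show ?thesis
      using that l_closed by (simp add: G.minus_eq G.a_assoc G.r_neg)
  qed
  have kernel: "t \<odot>\<^bsub>bimodule G l r\<^esub> m = \<zero>\<^bsub>G\<^esub>" if "t \<in> mult_kernel k A" and m: "m \<in> carrier G" for t m
  proof -
    have t: "t \<in> carrier (tensor_ring k A)" "tensor_lift A (\<lambda>a b. a \<otimes>\<^bsub>A\<^esub> b) t = \<zero>\<^bsub>A\<^esub>"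
      using that(1) by (auto simp: mult_kernel_def a_kernel_def')
    then obtain x where x: "x \<in> carrier (formal_ring A)" "t = alg.tens_hom x"
      unfolding alg.carrier_tensor_ring by auto
    \<comment> \<open>\<open>y\<close> is the representative that \<open>tensor_lift\<close> itself
      picks, so the value of the multiplication map at \<open>t\<close> is a concrete sum over the
      keys of \<open>y\<close>.\<close>
    define y where "y = (SOME y. y \<in> t)"
    have "y \<in> t"
      unfolding y_def x(2) by (rule someI[of _ x]) (rule I.a_rcos_self[OF x(1)])
    then obtain i where i: "i \<in> tensor_ideal k A" "y = i + x"
      by (auto simp: a_r_coset_def' x(2))
    then have y: "Poly_Mapping.keys y \<subseteq> carrier A \<times> carrier A" "t = alg.tens_hom y"
      using x I.Icarr[of i] keys_add_subset[of i _ x] alg.tens_hom_eqI[of y x] by auto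
    have "act y m = l (AA.act y \<one>\<^bsub>A\<^esub>) m"
      using y(1)
      by (induction y rule: formal_induct)
        (use m in \<open>simp_all add: act_0 AA.act_0 l_zero act_of AA.act_of sym l_mult act_diff
          AA.act_diff AA.act_closed l_diff\<close>)
    also have "AA.act y \<one>\<^bsub>A\<^esub> = tensor_lift A (\<lambda>a b. a \<otimes>\<^bsub>A\<^esub> b) t"
      unfolding AA.act_def frag_sum_def tensor_lift_def Let_def y_def[symmetric]
      by (rule alg.finsum_cong') (use y(1) in auto)
    finally show ?thesis
      using smult_bimodule[of y m] y m t(2) l_zero by simp
  qed
  \<comment> \<open>Membership in the carrier is carried through the induction because the sum case
    needs it for distributivity.\<close>
  have "t \<odot>\<^bsub>bimodule G l r\<^esub> m = \<zero>\<^bsub>G\<^esub> \<and> t \<in> carrier (tensor_ring k A)"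
    if "t \<in> ideal_prod (tensor_ring k A) (mult_kernel k A) (mult_kernel k A)" and m: "m \<in> carrier G" for t m
    using that(1)
  proof (induction t rule: ideal_prod.induct)
    case (prod i j)
    then have "i \<in> carrier (tensor_ring k A)" "j \<in> carrier (tensor_ring k A)"
      by (auto simp: mult_kernel_def a_kernel_def')
    then show ?case
      using prod m B.smult_assoc1[of i j m] B.smult_r_null by (simp add: kernel)
  next
    case (sum s t)
    then show ?case using m B.smult_l_distr[of s t m] by simp
  qed
  then show ?thesis
    unfolding P_module_def using module_bimodule by simp
qed

end

section \<open>Additive maps and general modules over the tensor ring\<close>

context abelian_group
begin

lemma diff_add_cancel: "x \<in> carrier G \<Longrightarrow> y \<in> carrier G \<Longrightarrow> x \<ominus> y \<oplus> y = x"
  by (simp add: minus_eq a_assoc l_neg)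

lemma add_diff_cancel: "x \<in> carrier G \<Longrightarrow> y \<in> carrier G \<Longrightarrow> x \<oplus> y \<ominus> y = x"
  by (simp add: minus_eq a_assoc r_neg)

lemma diff_eq_0_iff:
  assumes "x \<in> carrier G" "y \<in> carrier G"
  shows "x \<ominus> y = \<zero> \<longleftrightarrow> x = y"
  using assms diff_add_cancel[of x y] by (auto simp: diff_self)

end

lemma additive_diff:
  assumes "abelian_group G" "abelian_group H"
    and "\<And>x. x \<in> carrier G \<Longrightarrow> h x \<in> carrier H"
    and "\<And>x y. x \<in> carrier G \<Longrightarrow> y \<in> carrier G \<Longrightarrow> h (x \<oplus>\<^bsub>G\<^esub> y) = h x \<oplus>\<^bsub>H\<^esub> h y"
    and "x \<in> carrier G" "y \<in> carrier G"
  shows "h (x \<ominus>\<^bsub>G\<^esub> y) = h x \<ominus>\<^bsub>H\<^esub> h y"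
proof -
  interpret G: abelian_group G by fact
  interpret H: abelian_group H by fact
  have "h x = h (x \<ominus>\<^bsub>G\<^esub> y) \<oplus>\<^bsub>H\<^esub> h y"
    using assms(5,6) by (simp add: G.diff_add_cancel flip: assms(4))
  then show ?thesis
    using assms(3,5,6) by (simp add: H.add_diff_cancel)
qed

lemma mod_hom_comp:
  "g \<in> mod_hom T X Y \<Longrightarrow> h \<in> mod_hom T Y Z \<Longrightarrow> (\<lambda>x. h (g x)) \<in> mod_hom T X Z"
  by (auto simp: mod_hom_def Pi_iff)

context algebra
begin

lemma ideal_prod_mult_kernel:
  "t \<in> ideal_prod (tensor_ring R M) (mult_kernel R M) (mult_kernel R M) \<Longrightarrow> t \<in> carrier (tensor_ring R M)"
proof (induction t rule: ideal_prod.induct)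
  interpret T: cring "tensor_ring R M" by (rule cring_tensor_ring)
  show "i \<otimes>\<^bsub>tensor_ring R M\<^esub> j \<in> carrier (tensor_ring R M)"
    if "i \<in> mult_kernel R M" "j \<in> mult_kernel R M" for i j
    using that by (simp add: mult_kernel_def a_kernel_def')
  show "s \<oplus>\<^bsub>tensor_ring R M\<^esub> t \<in> carrier (tensor_ring R M)"
    if "s \<in> carrier (tensor_ring R M)" "t \<in> carrier (tensor_ring R M)" for s t
    using that by simp
qed

lemma smult_tens:
  assumes "module (tensor_ring R M) X" "a \<in> carrier M" "b \<in> carrier M" "u \<in> carrier X"
  shows "tens R M a b \<odot>\<^bsub>X\<^esub> u = tens R M a \<one>\<^bsub>M\<^esub> \<odot>\<^bsub>X\<^esub> (tens R M \<one>\<^bsub>M\<^esub> b \<odot>\<^bsub>X\<^esub> u)"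
proof -
  interpret X: module "tensor_ring R M" X by fact
  show ?thesis
    using assms(2-) by (simp add: tens_mult flip: X.smult_assoc1)
qed

text \<open>Converse to the construction of \<open>bimodule\<close>: a module over the tensor ring
  is restricted along its two copies of A. This lets L enter the extension on the same footing as
  the endomorphisms of E.\<close>

lemma balanced_bimodule_tens:
  assumes "module (tensor_ring R M) X"
  shows "balanced_bimodule R M X (\<lambda>a u. tens R M a \<one>\<^bsub>M\<^esub> \<odot>\<^bsub>X\<^esub> u) (\<lambda>b u. tens R M \<one>\<^bsub>M\<^esub> b \<odot>\<^bsub>X\<^esub> u)"
proof -
  interpret X: module "tensor_ring R M" X by fact
  show ?thesis
    by unfold_locales
      (simp_all add: X.smult_r_distr tens_add_left tens_add_right X.smult_l_distr tens_mult tens_one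
        tens_balanced flip: X.smult_assoc1)
qed

lemma k_module_simps [simp]:
  "carrier (k_module R M X) = carrier X" "add (k_module R M X) = add X" "zero (k_module R M X) = zero X"
  "s \<odot>\<^bsub>k_module R M X\<^esub> u = lact R M X (s \<odot>\<^bsub>M\<^esub> \<one>\<^bsub>M\<^esub>) u"
  by (simp_all add: k_module_def)

lemma smult_one_mult:
  assumes "s \<in> carrier R" "t \<in> carrier R"
  shows "(s \<otimes>\<^bsub>R\<^esub> t) \<odot>\<^bsub>M\<^esub> \<one>\<^bsub>M\<^esub> = (s \<odot>\<^bsub>M\<^esub> \<one>\<^bsub>M\<^esub>) \<otimes>\<^bsub>M\<^esub> (t \<odot>\<^bsub>M\<^esub> \<one>\<^bsub>M\<^esub>)"
  using assms smult_assoc2[of s "\<one>\<^bsub>M\<^esub>" "t \<odot>\<^bsub>M\<^esub> \<one>\<^bsub>M\<^esub>"] by (simp add: smult_assoc1)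

lemma module_k_module:
  assumes "module (tensor_ring R M) X"
  shows "module R (k_module R M X)"
proof -
  interpret X: module "tensor_ring R M" X by fact
  show ?thesis
  proof (rule moduleI)
    show "abelian_group (k_module R M X)"
      by (rule abelian_group_cong[OF X.M.abelian_group_axioms]) simp_all
  qed (simp_all add: R_cring lact_def X.smult_r_distr smult_l_distr tens_add_left X.smult_l_distr
      smult_one_mult tens_mult tens_one flip: X.smult_assoc1)
qed

lemma dact_eq:
  assumes "module (tensor_ring R M) X" "a \<in> carrier M" "u \<in> carrier X"
  shows "dact R M X a u = tens R M \<one>\<^bsub>M\<^esub> a \<odot>\<^bsub>X\<^esub> u \<ominus>\<^bsub>X\<^esub> tens R M a \<one>\<^bsub>M\<^esub> \<odot>\<^bsub>X\<^esub> u"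
proof -
  interpret X: module "tensor_ring R M" X by fact
  show ?thesis
    using assms(2,3) by (simp add: dact_def X.R.minus_eq X.M.minus_eq X.smult_l_distr X.smult_l_minus)
qed

end

section \<open>Commutators, endomorphisms and differential operators\<close>

context ring
begin

lemma commutator_closed [simp]: "x \<in> carrier R \<Longrightarrow> y \<in> carrier R \<Longrightarrow> commutator R x y \<in> carrier R"
  by (simp add: commutator_def)

lemma commutator_self: "x \<in> carrier R \<Longrightarrow> commutator R x x = \<zero>"
  by (simp add: commutator_def diff_self)

lemma commutator_eq_0_iff:
  "x \<in> carrier R \<Longrightarrow> y \<in> carrier R \<Longrightarrow> commutator R x y = \<zero> \<longleftrightarrow> x \<otimes> y = y \<otimes> x"
  by (simp add: commutator_def diff_eq_0_iff)

lemma commutator_zero_right [simp]: "x \<in> carrier R \<Longrightarrow> commutator R x \<zero> = \<zero>"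
  by (simp add: commutator_eq_0_iff)

lemma commutator_zero_left [simp]: "x \<in> carrier R \<Longrightarrow> commutator R \<zero> x = \<zero>"
  by (simp add: commutator_eq_0_iff)

lemma commutator_add_left:
  assumes "x \<in> carrier R" "y \<in> carrier R" "z \<in> carrier R"
  shows "commutator R (x \<oplus> y) z = commutator R x z \<oplus> commutator R y z"
  unfolding commutator_def using assms by algebra

lemma commutator_add_right:
  assumes "x \<in> carrier R" "y \<in> carrier R" "z \<in> carrier R"
  shows "commutator R x (y \<oplus> z) = commutator R x y \<oplus> commutator R x z"
  unfolding commutator_def using assms by algebra

lemma commutator_diff_left:
  assumes "x \<in> carrier R" "y \<in> carrier R" "z \<in> carrier R"
  shows "commutator R (x \<ominus> y) z = commutator R x z \<ominus> commutator R y z"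
  unfolding commutator_def using assms by algebra

lemma commutator_mult_left:
  assumes "x \<in> carrier R" "y \<in> carrier R" "z \<in> carrier R"
  shows "commutator R (x \<otimes> y) z = x \<otimes> commutator R y z \<oplus> commutator R x z \<otimes> y"
  unfolding commutator_def using assms by algebra

lemma commutator_jacobi:
  assumes "x \<in> carrier R" "y \<in> carrier R" "z \<in> carrier R"
  shows "commutator R x (commutator R y z) \<oplus> commutator R y (commutator R z x)
    \<oplus> commutator R z (commutator R x y) = \<zero>"
  unfolding commutator_def using assms by algebra

lemma commutator_mult_right:
  assumes "x \<in> carrier R" "y \<in> carrier R" "z \<in> carrier R"
  shows "commutator R x (y \<otimes> z) = commutator R x y \<otimes> z \<oplus> y \<otimes> commutator R x z"
  unfolding commutator_def using assms by algebra

text \<open>The Jacobi identity in the form that tests A-linearity: for a scalar \<open>z\<close> it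
  reduces the commutator of \<open>commutator R x y\<close> with \<open>z\<close> to those of
  \<open>x\<close> and \<open>y\<close> with \<open>z\<close>.\<close>

lemma commutator_commutator_left:
  assumes "x \<in> carrier R" "y \<in> carrier R" "z \<in> carrier R"
  shows "commutator R (commutator R x y) z
    = commutator R x (commutator R y z) \<ominus> commutator R y (commutator R x z)"
  unfolding commutator_def using assms by algebra

text \<open>To be read with \<open>x\<close>, \<open>y\<close> the endomorphism parts \<phi>,
  \<psi>, with \<open>a\<close>, \<open>b\<close> the operators \<rho>(u), \<rho>(v), and with
  \<open>c\<close> the operator \<rho>([u, v]).\<close>

lemma commutator_extension:
  assumes "x \<in> carrier R" "y \<in> carrier R" "a \<in> carrier R" "b \<in> carrier R" "c \<in> carrier R"
  shows "commutator R x y \<oplus> commutator R a y \<ominus> commutator R b x \<oplus> (commutator R a b \<ominus> c) \<oplus> c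
    = commutator R (x \<oplus> a) (y \<oplus> b)"
  unfolding commutator_def using assms by algebra

end

section \<open>The ring of k-linear endomorphisms and its sub-bimodules\<close>

lemma fun_ring_carrier [simp]: "carrier (fun_ring E X) = X"
  by (simp add: fun_ring_def)

lemma fun_ring_apply [simp]:
  "e \<in> carrier E \<Longrightarrow> (g \<oplus>\<^bsub>fun_ring E X\<^esub> h) e = g e \<oplus>\<^bsub>E\<^esub> h e"
  "e \<in> carrier E \<Longrightarrow> (g \<otimes>\<^bsub>fun_ring E X\<^esub> h) e = g (h e)"
  "e \<in> carrier E \<Longrightarrow> \<zero>\<^bsub>fun_ring E X\<^esub> e = \<zero>\<^bsub>E\<^esub>"
  "e \<in> carrier E \<Longrightarrow> \<one>\<^bsub>fun_ring E X\<^esub> e = e"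
  by (simp_all add: fun_ring_def compose_def)

lemma fun_ring_extensional [simp]:
  "g \<oplus>\<^bsub>fun_ring E X\<^esub> h \<in> extensional (carrier E)"
  "g \<otimes>\<^bsub>fun_ring E X\<^esub> h \<in> extensional (carrier E)"
  "\<zero>\<^bsub>fun_ring E X\<^esub> \<in> extensional (carrier E)"
  "\<one>\<^bsub>fun_ring E X\<^esub> \<in> extensional (carrier E)"
  by (simp_all add: fun_ring_def compose_def)

locale k_algebra_module = alg: algebra k A + E: module A E
  for k :: "('k, 'x) ring_scheme" and A :: "('k, 'a, 'y) module_scheme" and E :: "('a, 'e, 'w) module_scheme"
begin

abbreviation "S \<equiv> End_k_ring k A E"

abbreviation "sc \<equiv> scalar E"

lemma End_kI:
  assumes "g \<in> extensional (carrier E)" "\<And>e. e \<in> carrier E \<Longrightarrow> g e \<in> carrier E"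
    "\<And>e e'. e \<in> carrier E \<Longrightarrow> e' \<in> carrier E \<Longrightarrow> g (e \<oplus>\<^bsub>E\<^esub> e') = g e \<oplus>\<^bsub>E\<^esub> g e'"
    "\<And>s e. s \<in> carrier k \<Longrightarrow> e \<in> carrier E \<Longrightarrow>
      g ((s \<odot>\<^bsub>A\<^esub> \<one>\<^bsub>A\<^esub>) \<odot>\<^bsub>E\<^esub> e) = (s \<odot>\<^bsub>A\<^esub> \<one>\<^bsub>A\<^esub>) \<odot>\<^bsub>E\<^esub> g e"
  shows "g \<in> End_k k A E"
  using assms by (auto simp: End_k_def PiE_def)

lemma End_kD [simp]:
  assumes "g \<in> End_k k A E"
  shows "g \<in> extensional (carrier E)" "e \<in> carrier E \<Longrightarrow> g e \<in> carrier E"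
    "e \<in> carrier E \<Longrightarrow> e' \<in> carrier E \<Longrightarrow> g (e \<oplus>\<^bsub>E\<^esub> e') = g e \<oplus>\<^bsub>E\<^esub> g e'"
    "s \<in> carrier k \<Longrightarrow> e \<in> carrier E \<Longrightarrow>
      g ((s \<odot>\<^bsub>A\<^esub> \<one>\<^bsub>A\<^esub>) \<odot>\<^bsub>E\<^esub> e) = (s \<odot>\<^bsub>A\<^esub> \<one>\<^bsub>A\<^esub>) \<odot>\<^bsub>E\<^esub> g e"
  using assms by (auto simp: End_k_def PiE_def)

lemma End_k_eqI:
  assumes "g \<in> extensional (carrier E)" "h \<in> extensional (carrier E)"
    "\<And>e. e \<in> carrier E \<Longrightarrow> g e = h e"
  shows "g = h"
  using assms by (rule extensionalityI)

lemma scalar_apply [simp]: "e \<in> carrier E \<Longrightarrow> sc a e = a \<odot>\<^bsub>E\<^esub> e"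
  by (simp add: scalar_def)

lemma scalar_extensional [simp]: "sc a \<in> extensional (carrier E)"
  by (simp add: scalar_def)

lemma ring_End_k: "ring S"
proof (rule ringI)
  show "abelian_group S"
  proof (rule abelian_groupI)
    fix g assume g: "g \<in> carrier S"
    show "\<exists>h\<in>carrier S. h \<oplus>\<^bsub>S\<^esub> g = \<zero>\<^bsub>S\<^esub>"
    proof
      show "(\<lambda>e \<in> carrier E. \<ominus>\<^bsub>E\<^esub> g e) \<in> carrier S"
        unfolding fun_ring_carrier
        by (rule End_kI) (use g in \<open>simp_all add: E.M.minus_add E.smult_r_minus\<close>)
      show "(\<lambda>e \<in> carrier E. \<ominus>\<^bsub>E\<^esub> g e) \<oplus>\<^bsub>S\<^esub> g = \<zero>\<^bsub>S\<^esub>"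
        by (rule End_k_eqI) (use g in \<open>simp_all add: E.M.l_neg\<close>)
    qed
  next
    show "g \<oplus>\<^bsub>S\<^esub> h \<in> carrier S" if "g \<in> carrier S" "h \<in> carrier S" for g h
      unfolding fun_ring_carrier
      by (rule End_kI) (use that in \<open>simp_all add: E.M.a_ac E.smult_r_distr\<close>)
    show "\<zero>\<^bsub>S\<^esub> \<in> carrier S"
      unfolding fun_ring_carrier by (rule End_kI) simp_all
  qed (rule End_k_eqI; simp add: E.M.a_ac)+
  show "Group.monoid S"
  proof (rule monoidI)
    show "g \<otimes>\<^bsub>S\<^esub> h \<in> carrier S" if "g \<in> carrier S" "h \<in> carrier S" for g h
      unfolding fun_ring_carrier by (rule End_kI) (use that in simp_all)
    show "\<one>\<^bsub>S\<^esub> \<in> carrier S"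
      unfolding fun_ring_carrier by (rule End_kI) simp_all
  qed (rule End_k_eqI; simp)+
qed (rule End_k_eqI; simp)+

sublocale S: ring S by (rule ring_End_k)

lemmas End_k_closed [simp] = S.zero_closed[unfolded fun_ring_carrier] S.one_closed[unfolded fun_ring_carrier]
  S.a_closed[unfolded fun_ring_carrier] S.a_inv_closed[unfolded fun_ring_carrier]
  S.minus_closed[unfolded fun_ring_carrier] S.m_closed[unfolded fun_ring_carrier]
  S.commutator_closed[unfolded fun_ring_carrier]

lemma scalar_closed [simp]:
  assumes "a \<in> carrier A"
  shows "sc a \<in> End_k k A E"
  by (rule End_kI) (use assms in \<open>simp_all add: E.smult_r_distr alg.m_comm flip: E.smult_assoc1\<close>)

lemma scalar_add: "a \<in> carrier A \<Longrightarrow> b \<in> carrier A \<Longrightarrow> sc (a \<oplus>\<^bsub>A\<^esub> b) = sc a \<oplus>\<^bsub>S\<^esub> sc b"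
  by (auto intro!: End_k_eqI simp: E.smult_l_distr)

lemma scalar_mult: "a \<in> carrier A \<Longrightarrow> b \<in> carrier A \<Longrightarrow> sc (a \<otimes>\<^bsub>A\<^esub> b) = sc a \<otimes>\<^bsub>S\<^esub> sc b"
  by (auto intro!: End_k_eqI simp: E.smult_assoc1)

lemma scalar_one: "sc \<one>\<^bsub>A\<^esub> = \<one>\<^bsub>S\<^esub>"
  by (auto intro!: End_k_eqI)

lemma scalar_zero: "sc \<zero>\<^bsub>A\<^esub> = \<zero>\<^bsub>S\<^esub>"
  by (rule End_k_eqI) simp_all

lemma scalar_comm: "a \<in> carrier A \<Longrightarrow> b \<in> carrier A \<Longrightarrow> sc a \<otimes>\<^bsub>S\<^esub> sc b = sc b \<otimes>\<^bsub>S\<^esub> sc a"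
  by (simp add: alg.m_comm flip: scalar_mult)

lemma commutator_scalar [simp]:
  "a \<in> carrier A \<Longrightarrow> b \<in> carrier A \<Longrightarrow> commutator S (sc a) (sc b) = \<zero>\<^bsub>S\<^esub>"
  by (simp add: S.commutator_eq_0_iff scalar_comm)

lemma scalar_diff:
  assumes "a \<in> carrier A" "b \<in> carrier A"
  shows "sc (a \<ominus>\<^bsub>A\<^esub> b) = sc a \<ominus>\<^bsub>S\<^esub> sc b"
  by (rule additive_diff[OF alg.M.abelian_group_axioms S.abelian_group_axioms])
    (use assms in \<open>simp_all add: scalar_add\<close>)

text \<open>Turns \<open>k\<close>-linearity into an equation in the ring \<open>S\<close>, the form
  demanded by \<open>scalars\<close>.\<close>

lemma scalar_k:
  "g \<in> End_k k A E \<Longrightarrow> s \<in> carrier k \<Longrightarrow> g \<otimes>\<^bsub>S\<^esub> sc (s \<odot>\<^bsub>A\<^esub> \<one>\<^bsub>A\<^esub>) = sc (s \<odot>\<^bsub>A\<^esub> \<one>\<^bsub>A\<^esub>) \<otimes>\<^bsub>S\<^esub> g"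
  by (rule End_k_eqI) simp_all

lemma fun_lmult_eq: "fun_lmult E c g = sc c \<otimes>\<^bsub>S\<^esub> g"
  and fun_rmult_eq: "fun_rmult E c g = g \<otimes>\<^bsub>S\<^esub> sc c"
  by (simp_all add: fun_ring_def)

text \<open>The A-linear maps are the centralizer of the scalars in \<open>S\<close>, so A-linearity
  can be handled by commutator algebra instead of pointwise.\<close>

lemma End_A_iff:
  "g \<in> End_A A E \<longleftrightarrow> g \<in> End_k k A E \<and> (\<forall>a \<in> carrier A. g \<otimes>\<^bsub>S\<^esub> sc a = sc a \<otimes>\<^bsub>S\<^esub> g)"
proof
  assume g: "g \<in> End_A A E"
  have "g \<in> End_k k A E"
    by (rule End_kI) (use g in \<open>auto simp: End_A_def mod_hom_def\<close>)
  moreover have "g \<otimes>\<^bsub>S\<^esub> sc a = sc a \<otimes>\<^bsub>S\<^esub> g" if "a \<in> carrier A" for a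
    by (rule End_k_eqI) (use g that in \<open>auto simp: End_A_def mod_hom_def Pi_iff\<close>)
  ultimately show "g \<in> End_k k A E \<and> (\<forall>a \<in> carrier A. g \<otimes>\<^bsub>S\<^esub> sc a = sc a \<otimes>\<^bsub>S\<^esub> g)"
    by blast
next
  assume g: "g \<in> End_k k A E \<and> (\<forall>a \<in> carrier A. g \<otimes>\<^bsub>S\<^esub> sc a = sc a \<otimes>\<^bsub>S\<^esub> g)"
  have "g (a \<odot>\<^bsub>E\<^esub> e) = a \<odot>\<^bsub>E\<^esub> g e" if "a \<in> carrier A" "e \<in> carrier E" for a e
  proof -
    have "(g \<otimes>\<^bsub>S\<^esub> sc a) e = (sc a \<otimes>\<^bsub>S\<^esub> g) e" using g that by simp
    then show ?thesis using conjunct1[OF g] that by simp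
  qed
  then show "g \<in> End_A A E"
    using g by (auto simp: End_A_def mod_hom_def)
qed

lemma End_A_End_k [simp]: "g \<in> End_A A E \<Longrightarrow> g \<in> End_k k A E"
  by (simp add: End_A_iff)

lemma End_A_comm: "g \<in> End_A A E \<Longrightarrow> a \<in> carrier A \<Longrightarrow> g \<otimes>\<^bsub>S\<^esub> sc a = sc a \<otimes>\<^bsub>S\<^esub> g"
  by (simp add: End_A_iff)

lemma Diff1_End_k [simp]: "g \<in> Diff1 k A E \<Longrightarrow> g \<in> End_k k A E"
  by (simp add: Diff1_def)

lemma End_A_iff_commutator:
  "g \<in> End_A A E \<longleftrightarrow> g \<in> End_k k A E \<and> (\<forall>a \<in> carrier A. commutator S g (sc a) = \<zero>\<^bsub>S\<^esub>)"
  unfolding End_A_iff by (auto simp: S.commutator_eq_0_iff)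

lemma End_A_Diff1: "g \<in> End_A A E \<Longrightarrow> g \<in> Diff1 k A E"
  unfolding End_A_iff_commutator Diff1_def by simp

text \<open>The bimodule laws are inherited from associativity and distributivity in
  \<open>S\<close>. Composition on the right reverses the order of scalars, so \<open>r_mult\<close>
  depends on their commuting.\<close>

lemma sub_bimodule:
  assumes X: "X \<subseteq> End_k k A E" and zero: "\<zero>\<^bsub>S\<^esub> \<in> X"
    and diff: "\<And>g h. g \<in> X \<Longrightarrow> h \<in> X \<Longrightarrow> g \<ominus>\<^bsub>S\<^esub> h \<in> X"
    and mult: "\<And>a g. a \<in> carrier A \<Longrightarrow> g \<in> X \<Longrightarrow> sc a \<otimes>\<^bsub>S\<^esub> g \<in> X \<and> g \<otimes>\<^bsub>S\<^esub> sc a \<in> X"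
  shows "balanced_bimodule k A (fun_ring E X) (fun_lmult E) (fun_rmult E)"
proof -
  have add_eq: "add (fun_ring E X) = add S" and zero_eq: "zero (fun_ring E X) = zero S"
    by (simp_all add: fun_ring_def)
  have X': "g \<in> End_k k A E" if "g \<in> X" for g using X that by auto
  have neg: "\<ominus>\<^bsub>S\<^esub> g \<in> X" if "g \<in> X" for g
    using diff[OF zero that] X'[OF that] by (simp add: S.minus_eq)
  have add: "g \<oplus>\<^bsub>S\<^esub> h \<in> X" if "g \<in> X" "h \<in> X" for g h
    using diff[OF that(1) neg[OF that(2)]] X'[OF that(2)] by (simp add: S.minus_eq)
  interpret X: abelian_group "fun_ring E X"
  proof (rule abelian_groupI)
    show "\<exists>h\<in>carrier (fun_ring E X). h \<oplus>\<^bsub>fun_ring E X\<^esub> g = \<zero>\<^bsub>fun_ring E X\<^esub>"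
      if "g \<in> carrier (fun_ring E X)" for g
      using neg[of g] that X'[of g]
      by (intro bexI[of _ "\<ominus>\<^bsub>S\<^esub> g"]) (simp_all add: add_eq zero_eq S.l_neg)
  qed (simp_all add: add_eq zero_eq add zero X' S.a_ac)
  show ?thesis
    unfolding fun_lmult_eq fun_rmult_eq
    by unfold_locales
      (simp_all add: add_eq X' mult scalar_add scalar_mult scalar_one S.l_distr S.r_distr S.m_assoc scalar_k,
        simp add: X' scalar_comm flip: S.m_assoc)
qed

lemma End_A_diff:
  assumes "g \<in> End_A A E" "h \<in> End_A A E"
  shows "g \<ominus>\<^bsub>S\<^esub> h \<in> End_A A E"
  using assms unfolding End_A_iff_commutator by (simp add: S.commutator_diff_left S.diff_self)

lemma balanced_bimodule_End_A:
  "balanced_bimodule k A (fun_ring E (End_A A E)) (fun_lmult E) (fun_rmult E)"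
proof (rule sub_bimodule)
  show "\<zero>\<^bsub>S\<^esub> \<in> End_A A E"
    by (simp add: End_A_iff)
  show "sc a \<otimes>\<^bsub>S\<^esub> g \<in> End_A A E \<and> g \<otimes>\<^bsub>S\<^esub> sc a \<in> End_A A E"
    if "a \<in> carrier A" "g \<in> End_A A E" for a g
    using that unfolding End_A_iff_commutator
    by (simp add: S.commutator_mult_left)
qed (auto intro: End_A_diff)

lemma balanced_bimodule_Diff1:
  "balanced_bimodule k A (fun_ring E (Diff1 k A E)) (fun_lmult E) (fun_rmult E)"
proof (rule sub_bimodule)
  show "\<zero>\<^bsub>S\<^esub> \<in> Diff1 k A E"
    by (rule End_A_Diff1) (simp add: End_A_iff)
  show "g \<ominus>\<^bsub>S\<^esub> h \<in> Diff1 k A E" if "g \<in> Diff1 k A E" "h \<in> Diff1 k A E" for g h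
    using that unfolding Diff1_def by (simp add: S.commutator_diff_left S.diff_self)
  show "sc a \<otimes>\<^bsub>S\<^esub> g \<in> Diff1 k A E \<and> g \<otimes>\<^bsub>S\<^esub> sc a \<in> Diff1 k A E"
    if "a \<in> carrier A" "g \<in> Diff1 k A E" for a g
    using that unfolding Diff1_def by (simp add: S.commutator_mult_left)
qed auto

text \<open>By Jacobi, [[g, h], a] = [g, [h, a]] - [h, [g, a]]. The first term vanishes because h is
  A-linear, the second because [g, a] is a scalar, with which h commutes.\<close>

lemma End_A_commutator:
  assumes "g \<in> End_k k A E" "h \<in> End_A A E"
    and "\<And>a. a \<in> carrier A \<Longrightarrow> \<exists>b \<in> carrier A. commutator S g (sc a) = sc b"
  shows "commutator S g h \<in> End_A A E"
proof -
  have "commutator S (commutator S g h) (sc a) = \<zero>\<^bsub>S\<^esub>" if "a \<in> carrier A" for a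
  proof -
    obtain b where b: "b \<in> carrier A" "commutator S g (sc a) = sc b"
      using assms(3) \<open>a \<in> carrier A\<close> by blast
    have "commutator S h (sc c) = \<zero>\<^bsub>S\<^esub>" if "c \<in> carrier A" for c
      using assms(2) that unfolding End_A_iff_commutator by simp
    then show ?thesis
      using assms(1,2) that b
      by (simp add: S.commutator_commutator_left S.diff_self)
  qed
  then show ?thesis
    using assms(1,2) unfolding End_A_iff_commutator by simp
qed

end

section \<open>Connections with \<open>\<rho>(D) = 1\<close>\<close>

text \<open>Isolates the normalisation on the central element as a locale so that it can be
  interpreted a second time, for \<rho>', when a section is built.\<close>

locale unital_connection = L_connection k A f L E \<rho>
  for k :: "('k, 'x) ring_scheme" and A :: "('k, 'a, 'y) module_scheme"
    and f :: "('a \<Rightarrow> 'a) \<Rightarrow> ('a \<Rightarrow> 'a) \<Rightarrow> 'a" and L :: "('a, 'l, 'z) dlie_scheme"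
    and E :: "('a, 'e, 'w) module_scheme" and \<rho> :: "'l \<Rightarrow> 'e \<Rightarrow> 'e" +
  assumes rho_cent: "\<rho> (cent L) = (\<lambda>e \<in> carrier E. e)"
begin

sublocale KE: k_algebra_module k A E
  by (intro k_algebra_module.intro algebra module_axioms)

abbreviation "T \<equiv> tensor_ring k A"

lemma module_L: "module T L"
  using P_module by (simp add: P_module_def)

sublocale LM: module T L by (rule module_L)

sublocale LL: lie_algebra k "k_module k A L" "lie L" by (rule lie_algebra)

lemma anchor_closed [simp]: "u \<in> carrier L \<Longrightarrow> a \<in> carrier A \<Longrightarrow> anchor L u a \<in> carrier A"
  using anchor_hom by (auto simp: mod_hom_def Der_module_def Der_def Pi_iff)

lemma lie_closed [simp]: "u \<in> carrier L \<Longrightarrow> v \<in> carrier L \<Longrightarrow> lie L u v \<in> carrier L"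
  using LL.br_closed by simp

lemma smult_Diff1_tens:
  "a \<in> carrier A \<Longrightarrow> b \<in> carrier A \<Longrightarrow> g \<in> Diff1 k A E \<Longrightarrow>
    tens k A a b \<odot>\<^bsub>Diff1_module k A E\<^esub> g = KE.sc a \<otimes>\<^bsub>KE.S\<^esub> (g \<otimes>\<^bsub>KE.S\<^esub> KE.sc b)"
  unfolding Diff1_module_def
  by (simp add: smult_bimodule_tens[OF KE.balanced_bimodule_Diff1]) (simp add: fun_ring_def)

lemma add_Diff1: "g \<oplus>\<^bsub>Diff1_module k A E\<^esub> h = g \<oplus>\<^bsub>KE.S\<^esub> h"
  unfolding Diff1_module_def by (simp add: fun_ring_def)

lemma carrier_Diff1 [simp]: "carrier (Diff1_module k A E) = Diff1 k A E"
  by (simp add: Diff1_module_def)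

lemma module_Diff1: "module T (Diff1_module k A E)"
  unfolding Diff1_module_def by (rule module_bimodule[OF KE.balanced_bimodule_Diff1])

lemma rho_Diff1 [simp]: "u \<in> carrier L \<Longrightarrow> \<rho> u \<in> Diff1 k A E"
  using rho_hom by (auto simp: mod_hom_def Pi_iff)

lemma rho_closed [simp]: "u \<in> carrier L \<Longrightarrow> \<rho> u \<in> End_k k A E"
  by (rule KE.Diff1_End_k) simp

lemma rho_add: "u \<in> carrier L \<Longrightarrow> v \<in> carrier L \<Longrightarrow> \<rho> (u \<oplus>\<^bsub>L\<^esub> v) = \<rho> u \<oplus>\<^bsub>KE.S\<^esub> \<rho> v"
  using rho_hom by (simp add: mod_hom_def add_Diff1)

lemma rho_tens:
  "a \<in> carrier A \<Longrightarrow> b \<in> carrier A \<Longrightarrow> u \<in> carrier L \<Longrightarrow>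
    \<rho> (tens k A a b \<odot>\<^bsub>L\<^esub> u) = KE.sc a \<otimes>\<^bsub>KE.S\<^esub> (\<rho> u \<otimes>\<^bsub>KE.S\<^esub> KE.sc b)"
  using rho_hom by (simp add: mod_hom_def smult_Diff1_tens)

lemma rho_diff: "u \<in> carrier L \<Longrightarrow> v \<in> carrier L \<Longrightarrow> \<rho> (u \<ominus>\<^bsub>L\<^esub> v) = \<rho> u \<ominus>\<^bsub>KE.S\<^esub> \<rho> v"
  by (rule additive_diff[OF LM.M.abelian_group_axioms KE.S.abelian_group_axioms]) (simp_all add: rho_add)

lemma rho_zero: "\<rho> \<zero>\<^bsub>L\<^esub> = \<zero>\<^bsub>KE.S\<^esub>"
  using rho_diff[of "\<zero>\<^bsub>L\<^esub>" "\<zero>\<^bsub>L\<^esub>"] by (simp add: LM.M.diff_self KE.S.diff_self)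

lemma rho_lact: "a \<in> carrier A \<Longrightarrow> u \<in> carrier L \<Longrightarrow> \<rho> (lact k A L a u) = KE.sc a \<otimes>\<^bsub>KE.S\<^esub> \<rho> u"
  by (simp add: lact_def rho_tens KE.scalar_one)

lemma rho_cent_one: "\<rho> (cent L) = \<one>\<^bsub>KE.S\<^esub>"
  by (simp add: rho_cent fun_ring_def)

lemma lact_closed [simp]: "a \<in> carrier A \<Longrightarrow> u \<in> carrier L \<Longrightarrow> lact k A L a u \<in> carrier L"
  by (simp add: lact_def)

lemma rho_commutator:
  assumes "u \<in> carrier L" "a \<in> carrier A"
  shows "commutator KE.S (\<rho> u) (KE.sc a) = KE.sc (anchor L u a)"
proof -
  have "commutator KE.S (\<rho> u) (KE.sc a) = \<rho> (dact k A L a u)"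
    using assms by (simp add: KE.alg.dact_eq[OF module_L] rho_diff rho_tens KE.scalar_one commutator_def)
  also have "\<dots> = KE.sc (anchor L u a)"
    using assms by (simp add: dact_cent rho_lact rho_cent_one cent_closed)
  finally show ?thesis .
qed

text \<open>Bracketing the curvature with a leaves the scalar \<pi>(u)(\<pi>(v)(a)) -
  \<pi>(v)(\<pi>(u)(a)) - \<pi>([u, v])(a), which vanishes because the anchor preserves
  brackets.\<close>

lemma curvature_End_A:
  assumes "u \<in> carrier L" "v \<in> carrier L"
  shows "curvature k A L E \<rho> u v \<in> End_A A E"
proof -
  have "commutator KE.S (curvature k A L E \<rho> u v) (KE.sc a) = \<zero>\<^bsub>KE.S\<^esub>" if a: "a \<in> carrier A" for a
  proof -
    have "anchor L (lie L u v) a = anchor L u (anchor L v a) \<ominus>\<^bsub>A\<^esub> anchor L v (anchor L u a)"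
      using assms a by (simp add: anchor_lie der_lie_def)
    then show ?thesis
      using assms a by (simp add: curvature_def KE.S.commutator_diff_left KE.S.commutator_commutator_left
          rho_commutator KE.scalar_diff KE.S.diff_self)
  qed
  then show ?thesis
    using assms unfolding KE.End_A_iff_commutator by (simp add: curvature_def)
qed

section \<open>The extension\<close>

abbreviation "X \<equiv> End_ext k A L E \<rho>"

abbreviation "\<Phi> \<equiv> rho_shriek E \<rho>"

lemma End_ext_simps [simp]:
  "carrier X = End_A A E \<times> carrier L"
  "w \<oplus>\<^bsub>X\<^esub> z = (fst w \<oplus>\<^bsub>KE.S\<^esub> fst z, snd w \<oplus>\<^bsub>L\<^esub> snd z)"
  "\<zero>\<^bsub>X\<^esub> = (\<zero>\<^bsub>KE.S\<^esub>, \<zero>\<^bsub>L\<^esub>)"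
  "smult X = smult (End_ext_module k A L E)"
  "lie X = End_ext_lie k A L E \<rho>"
  "alpha X = (\<lambda>w. alpha L (snd w))"
  "anchor X = (\<lambda>w. anchor L (snd w))"
  "cent X = (\<zero>\<^bsub>KE.S\<^esub>, cent L)"
  by (simp_all add: End_ext_def module.defs dlie.defs End_ext_module_def bimodule_def fun_ring_def
      case_prod_unfold)

section \<open>Module structure of the kernel and of the extension\<close>

lemma module_End_A: "module T (End_A_module A E)"
  unfolding End_A_module_def by (rule module_bimodule[OF KE.balanced_bimodule_End_A])

lemma End_A_module_simps [simp]:
  "carrier (End_A_module A E) = End_A A E"
  "\<phi> \<oplus>\<^bsub>End_A_module A E\<^esub> \<psi> = \<phi> \<oplus>\<^bsub>KE.S\<^esub> \<psi>"
  "\<zero>\<^bsub>End_A_module A E\<^esub> = \<zero>\<^bsub>KE.S\<^esub>"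
  by (simp_all add: End_A_module_def fun_ring_def)

sublocale EM: module T "End_A_module A E" by (rule module_End_A)

lemma End_A_closed [simp]:
  "\<phi> \<in> End_A A E \<Longrightarrow> \<psi> \<in> End_A A E \<Longrightarrow> \<phi> \<oplus>\<^bsub>KE.S\<^esub> \<psi> \<in> End_A A E"
  "\<zero>\<^bsub>KE.S\<^esub> \<in> End_A A E"
  using EM.M.a_closed[of \<phi> \<psi>] EM.M.zero_closed by simp_all

lemma smult_End_A_tens:
  "a \<in> carrier A \<Longrightarrow> b \<in> carrier A \<Longrightarrow> g \<in> End_A A E \<Longrightarrow>
    tens k A a b \<odot>\<^bsub>End_A_module A E\<^esub> g = KE.sc a \<otimes>\<^bsub>KE.S\<^esub> (g \<otimes>\<^bsub>KE.S\<^esub> KE.sc b)"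
  unfolding End_A_module_def
  by (simp add: smult_bimodule_tens[OF KE.balanced_bimodule_End_A]) (simp add: fun_ring_def)

text \<open>The extension is a direct sum, and the conditions for a balanced bimodule hold because
  they hold in each summand.\<close>

lemma
  shows module_End_ext: "module T X"
    and smult_End_ext_tens: "a \<in> carrier A \<Longrightarrow> b \<in> carrier A \<Longrightarrow> w \<in> carrier X \<Longrightarrow>
      tens k A a b \<odot>\<^bsub>X\<^esub> w = (KE.sc a \<otimes>\<^bsub>KE.S\<^esub> (fst w \<otimes>\<^bsub>KE.S\<^esub> KE.sc b), tens k A a b \<odot>\<^bsub>L\<^esub> snd w)"
proof -
  \<comment> \<open>Copies of the data inside \<open>End_ext_module\<close>, which thereby becomes
    \<open>bimodule G l r\<close> by mere unfolding.\<close>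
  define G :: "(('e \<Rightarrow> 'e) \<times> 'l) ring" where
    "G = \<lparr>carrier = End_A A E \<times> carrier L, mult = undefined, one = undefined,
     zero = (\<lambda>e \<in> carrier E. \<zero>\<^bsub>E\<^esub>, \<zero>\<^bsub>L\<^esub>),
     add = (\<lambda>(\<phi>, u) (\<psi>, v). (\<lambda>e \<in> carrier E. \<phi> e \<oplus>\<^bsub>E\<^esub> \<psi> e, u \<oplus>\<^bsub>L\<^esub> v))\<rparr>"
  define l where "l = (\<lambda>c (\<phi>, u). (fun_lmult E c \<phi>, tens k A c \<one>\<^bsub>A\<^esub> \<odot>\<^bsub>L\<^esub> u))"
  define r where "r = (\<lambda>c (\<phi>, u). (fun_rmult E c \<phi>, tens k A \<one>\<^bsub>A\<^esub> c \<odot>\<^bsub>L\<^esub> u))"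
  have G [simp]: "carrier G = End_A A E \<times> carrier L" "\<zero>\<^bsub>G\<^esub> = (\<zero>\<^bsub>KE.S\<^esub>, \<zero>\<^bsub>L\<^esub>)"
    "w \<oplus>\<^bsub>G\<^esub> z = (fst w \<oplus>\<^bsub>KE.S\<^esub> fst z, snd w \<oplus>\<^bsub>L\<^esub> snd z)" for w z
    by (simp_all add: G_def fun_ring_def case_prod_unfold)
  have lr [simp]: "l c w = (fun_lmult E c (fst w), tens k A c \<one>\<^bsub>A\<^esub> \<odot>\<^bsub>L\<^esub> snd w)"
    "r c w = (fun_rmult E c (fst w), tens k A \<one>\<^bsub>A\<^esub> c \<odot>\<^bsub>L\<^esub> snd w)" for c w
    by (simp_all add: l_def r_def case_prod_unfold)
  have X_def: "End_ext_module k A L E = bimodule G l r"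
    by (simp only: End_ext_module_def G_def l_def r_def)
  interpret BE: balanced_bimodule k A "fun_ring E (End_A A E)" "fun_lmult E" "fun_rmult E"
    by (rule KE.balanced_bimodule_End_A)
  interpret BL: balanced_bimodule k A L "\<lambda>a u. tens k A a \<one>\<^bsub>A\<^esub> \<odot>\<^bsub>L\<^esub> u" "\<lambda>b u. tens k A \<one>\<^bsub>A\<^esub> b \<odot>\<^bsub>L\<^esub> u"
    by (rule KE.alg.balanced_bimodule_tens[OF module_L])
  have E_add: "\<phi> \<oplus>\<^bsub>fun_ring E (End_A A E)\<^esub> \<psi> = \<phi> \<oplus>\<^bsub>KE.S\<^esub> \<psi>" for \<phi> \<psi>
    by (simp add: fun_ring_def)
  have "abelian_group G"
  proof (rule abelian_groupI)
    fix w assume w: "w \<in> carrier G"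
    \<comment> \<open>The negative is formed in \<open>End_A_module\<close>, where it is known to be
      A-linear again.\<close>
    show "\<exists>z\<in>carrier G. z \<oplus>\<^bsub>G\<^esub> w = \<zero>\<^bsub>G\<^esub>"
      using w EM.M.a_inv_closed[of "fst w"] EM.M.l_neg[of "fst w"]
      by (intro bexI[of _ "(\<ominus>\<^bsub>End_A_module A E\<^esub> fst w, \<ominus>\<^bsub>L\<^esub> snd w)"]) (auto simp: LM.M.l_neg)
  qed (auto simp: KE.S.a_ac LM.M.a_ac)
  then have B: "balanced_bimodule k A G l r"
    by (intro balanced_bimodule.intro balanced_bimodule_axioms.intro algebra)
      (auto simp: BE.l_closed[simplified] BE.r_closed[simplified]
        BE.l_add[unfolded E_add, simplified] BE.r_add[unfolded E_add, simplified]
        BE.l_add_right[unfolded E_add, simplified] BE.r_add_right[unfolded E_add, simplified]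
        BE.l_mult[simplified] BE.r_mult[simplified] BE.l_one[simplified] BE.r_one[simplified]
        BE.l_r[simplified] BE.scalars[simplified]
        BL.l_add BL.r_add BL.l_add_right BL.r_add_right BL.l_mult BL.r_mult BL.l_one BL.r_one BL.l_r BL.scalars)
  show "module T X"
    by (rule module_cong[OF module_bimodule[OF B]])
      (auto simp: X_def fun_eq_iff)
  show "tens k A a b \<odot>\<^bsub>X\<^esub> w = (KE.sc a \<otimes>\<^bsub>KE.S\<^esub> (fst w \<otimes>\<^bsub>KE.S\<^esub> KE.sc b), tens k A a b \<odot>\<^bsub>L\<^esub> snd w)"
    if "a \<in> carrier A" "b \<in> carrier A" "w \<in> carrier X"
    using that smult_bimodule_tens[OF B, of a b w] KE.alg.smult_tens[OF module_L, of a b "snd w"]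
    by (auto simp: X_def KE.fun_lmult_eq KE.fun_rmult_eq)
qed

sublocale XM: module T X by (rule module_End_ext)

section \<open>The embedding by \<open>\<Phi>\<close> and \<open>snd\<close>\<close>

lemma Phi_eq: "\<Phi> w = fst w \<oplus>\<^bsub>KE.S\<^esub> \<rho> (snd w)"
  by (simp add: rho_shriek_def fun_ring_def case_prod_unfold)

lemma Phi_closed [simp]: "w \<in> carrier X \<Longrightarrow> \<Phi> w \<in> End_k k A E"
  by (auto simp: Phi_eq)

lemma snd_closed [simp]: "w \<in> carrier X \<Longrightarrow> snd w \<in> carrier L"
  by auto

lemma fst_closed [simp]: "w \<in> carrier X \<Longrightarrow> fst w \<in> End_A A E"
  by auto

text \<open>The endomorphism part is recovered by subtracting \<rho> of the second component. Each
  later equation in \<open>X\<close> thus splits into one in \<open>S\<close> and one in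
  \<open>L\<close>.\<close>

lemma End_ext_eqI:
  assumes "w \<in> carrier X" "z \<in> carrier X" "\<Phi> w = \<Phi> z" "snd w = snd z"
  shows "w = z"
proof -
  have "fst w = \<Phi> w \<ominus>\<^bsub>KE.S\<^esub> \<rho> (snd w)" "fst z = \<Phi> z \<ominus>\<^bsub>KE.S\<^esub> \<rho> (snd z)"
    using assms(1,2) by (auto simp: Phi_eq KE.S.add_diff_cancel)
  then show ?thesis
    using assms(3,4) by (simp add: prod_eq_iff)
qed

lemma Phi_add:
  assumes "w \<in> carrier X" "z \<in> carrier X"
  shows "\<Phi> (w \<oplus>\<^bsub>X\<^esub> z) = \<Phi> w \<oplus>\<^bsub>KE.S\<^esub> \<Phi> z"
  using assms by (auto simp: Phi_eq rho_add KE.S.a_ac)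

lemma Phi_diff:
  assumes "w \<in> carrier X" "z \<in> carrier X"
  shows "\<Phi> (w \<ominus>\<^bsub>X\<^esub> z) = \<Phi> w \<ominus>\<^bsub>KE.S\<^esub> \<Phi> z"
  by (rule additive_diff[OF XM.M.abelian_group_axioms KE.S.abelian_group_axioms])
    (use assms in \<open>simp_all add: Phi_add del: End_ext_simps\<close>)

lemma Phi_zero: "\<Phi> \<zero>\<^bsub>X\<^esub> = \<zero>\<^bsub>KE.S\<^esub>"
  by (simp add: Phi_eq rho_zero)

lemma Phi_tens:
  assumes "a \<in> carrier A" "b \<in> carrier A" "w \<in> carrier X"
  shows "\<Phi> (tens k A a b \<odot>\<^bsub>X\<^esub> w) = KE.sc a \<otimes>\<^bsub>KE.S\<^esub> (\<Phi> w \<otimes>\<^bsub>KE.S\<^esub> KE.sc b)"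
  unfolding smult_End_ext_tens[OF assms] using assms
  by (auto simp: Phi_eq rho_tens KE.S.l_distr KE.S.r_distr)

lemma snd_smult_tens:
  "a \<in> carrier A \<Longrightarrow> b \<in> carrier A \<Longrightarrow> w \<in> carrier X \<Longrightarrow>
    snd (tens k A a b \<odot>\<^bsub>X\<^esub> w) = tens k A a b \<odot>\<^bsub>L\<^esub> snd w"
  by (simp add: smult_End_ext_tens del: End_ext_simps)

lemma Phi_lact:
  "c \<in> carrier A \<Longrightarrow> w \<in> carrier X \<Longrightarrow> \<Phi> (lact k A X c w) = KE.sc c \<otimes>\<^bsub>KE.S\<^esub> \<Phi> w"
  by (simp add: lact_def Phi_tens KE.scalar_one del: End_ext_simps)

lemma snd_lact:
  "c \<in> carrier A \<Longrightarrow> w \<in> carrier X \<Longrightarrow> snd (lact k A X c w) = lact k A L c (snd w)"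
  by (simp add: lact_def snd_smult_tens del: End_ext_simps)

lemma lact_End_ext_closed [simp]:
  "c \<in> carrier A \<Longrightarrow> w \<in> carrier X \<Longrightarrow> lact k A X c w \<in> carrier X"
  by (simp add: lact_def del: End_ext_simps)

lemma snd_hom: "snd \<in> mod_hom T X L"
  by (rule KE.alg.mod_homI[OF module_End_ext module_L]) (auto simp: smult_End_ext_tens simp del: End_ext_simps(4))

lemma fst_hom: "fst \<in> mod_hom T X (End_A_module A E)"
  by (rule KE.alg.mod_homI[OF module_End_ext module_End_A])
    (auto simp: smult_End_ext_tens smult_End_A_tens simp del: End_ext_simps(4))

lemma Phi_Diff1:
  assumes "w \<in> carrier X"
  shows "\<Phi> w \<in> Diff1 k A E"
proof -
  interpret D: module T "Diff1_module k A E" by (rule module_Diff1)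
  show ?thesis
    using D.M.a_closed[of "fst w" "\<rho> (snd w)"] KE.End_A_Diff1[of "fst w"] assms
    by (auto simp: Phi_eq add_Diff1)
qed

lemma Phi_hom: "\<Phi> \<in> mod_hom T X (Diff1_module k A E)"
  by (rule KE.alg.mod_homI[OF module_End_ext module_Diff1])
    (simp_all add: Phi_Diff1 Phi_add Phi_tens add_Diff1 smult_Diff1_tens del: End_ext_simps)

text \<open>Both projections are linear over the tensor ring, so annihilation is checked
  componentwise: on A-linear maps by symmetry of the bimodule, on \<open>L\<close> by
  hypothesis.\<close>

lemma P_module_End_ext: "P_module k A X"
proof -
  have "P_module k A (End_A_module A E)"
    unfolding End_A_module_def
    by (rule P_module_symmetric[OF KE.balanced_bimodule_End_A])
      (simp add: KE.fun_lmult_eq KE.fun_rmult_eq KE.End_A_comm)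
  then have E0: "t \<odot>\<^bsub>End_A_module A E\<^esub> \<phi> = \<zero>\<^bsub>KE.S\<^esub>"
    if "t \<in> ideal_prod T (mult_kernel k A) (mult_kernel k A)" "\<phi> \<in> End_A A E" for t \<phi>
    using that by (simp add: P_module_def)
  have "t \<odot>\<^bsub>X\<^esub> w = \<zero>\<^bsub>X\<^esub>"
    if t: "t \<in> ideal_prod T (mult_kernel k A) (mult_kernel k A)" and w: "w \<in> carrier X" for t w
  proof (rule prod_eqI)
    have tT: "t \<in> carrier T" by (rule KE.alg.ideal_prod_mult_kernel[OF t])
    show "fst (t \<odot>\<^bsub>X\<^esub> w) = fst \<zero>\<^bsub>X\<^esub>"
      using fst_hom tT w E0[OF t, of "fst w"] by (auto simp: mod_hom_def)
    show "snd (t \<odot>\<^bsub>X\<^esub> w) = snd \<zero>\<^bsub>X\<^esub>"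
      using snd_hom tT w P_module t by (auto simp: mod_hom_def P_module_def)
  qed
  then show ?thesis
    unfolding P_module_def using module_End_ext by blast
qed

text \<open>The curvature summand supplies [\<rho>(u), \<rho>(v)] and subtracts \<rho>([u, v]);
  \<open>\<Phi>\<close> adds the latter back from the second component.\<close>

lemma Phi_lie:
  assumes "w \<in> carrier X" "z \<in> carrier X"
  shows "\<Phi> (lie X w z) = commutator KE.S (\<Phi> w) (\<Phi> z)"
proof -
  obtain \<phi> u \<psi> v where wz: "w = (\<phi>, u)" "z = (\<psi>, v)" "\<phi> \<in> carrier KE.S" "\<psi> \<in> carrier KE.S"
    "\<rho> u \<in> carrier KE.S" "\<rho> v \<in> carrier KE.S" "\<rho> (lie L u v) \<in> carrier KE.S"
    using assms by auto
  show ?thesis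
    unfolding Phi_eq wz(1,2) End_ext_simps End_ext_lie_def case_prod_conv fst_conv snd_conv
      curvature_def
    using wz(3-) by (rule KE.S.commutator_extension)
qed

lemma snd_lie: "snd (lie X w z) = lie L (snd w) (snd z)"
  by (simp add: End_ext_lie_def case_prod_unfold)

text \<open>Adding an A-linear map to \<rho>(u) does not change its commutators with scalars. This
  drives the Leibniz rule and the relation for \<open>dact\<close> in the extension.\<close>

lemma Phi_commutator:
  assumes "w \<in> carrier X" "a \<in> carrier A"
  shows "commutator KE.S (\<Phi> w) (KE.sc a) = KE.sc (anchor X w a)"
proof -
  have "commutator KE.S (fst w) (KE.sc a) = \<zero>\<^bsub>KE.S\<^esub>"
    using fst_closed[OF assms(1)] assms(2) unfolding KE.End_A_iff_commutator by simp
  then show ?thesis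
    using assms by (auto simp: Phi_eq KE.S.commutator_add_left rho_commutator)
qed

text \<open>Each of the four summands is A-linear: the three commutators because \<phi> and
  \<rho>(u) have scalar commutators with A, the last by \<open>curvature_End_A\<close>.\<close>

lemma lie_End_ext_closed [simp]:
  assumes "w \<in> carrier X" "z \<in> carrier X"
  shows "lie X w z \<in> carrier X"
proof -
  have comm: "commutator KE.S g \<phi> \<in> End_A A E"
    if "g \<in> End_k k A E" "\<phi> \<in> End_A A E" "\<And>a. a \<in> carrier A \<Longrightarrow> \<exists>b \<in> carrier A. commutator KE.S g (KE.sc a) = KE.sc b"
    for g \<phi>
    using that by (rule KE.End_A_commutator)
  have "commutator KE.S (fst w) (fst z) \<in> End_A A E"
  proof (rule comm)
    \<comment> \<open>The scalar is zero, since an A-linear map commutes with all scalars.\<close>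
    show "\<exists>b\<in>carrier A. commutator KE.S (fst w) (KE.sc a) = KE.sc b" if "a \<in> carrier A" for a
      using that fst_closed[OF assms(1)] unfolding KE.End_A_iff_commutator
      by (intro bexI[of _ "\<zero>\<^bsub>A\<^esub>"]) (simp_all add: KE.scalar_zero)
  qed (use assms in auto)
  moreover have "commutator KE.S (\<rho> u) \<phi> \<in> End_A A E" if "u \<in> carrier L" "\<phi> \<in> End_A A E" for u \<phi>
    by (rule comm) (use that rho_commutator in auto)
  moreover have "curvature k A L E \<rho> (snd w) (snd z) \<in> End_A A E"
    using assms by (intro curvature_End_A) auto
  ultimately show ?thesis
    using assms by (auto simp: End_ext_lie_def case_prod_unfold KE.End_A_diff)
qed

section \<open>The axioms of the extension, tested after \<open>\<Phi>\<close> and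
  \<open>snd\<close>\<close>

declare End_ext_simps(1-5) [simp del]

lemma snd_add: "snd (w \<oplus>\<^bsub>X\<^esub> z) = snd w \<oplus>\<^bsub>L\<^esub> snd z"
  and snd_zero: "snd \<zero>\<^bsub>X\<^esub> = \<zero>\<^bsub>L\<^esub>"
  by (simp_all add: End_ext_simps)

lemma lie_algebra_End_ext: "lie_algebra k (k_module k A X) (lie X)"
proof (intro lie_algebra.intro lie_algebra_axioms.intro KE.alg.module_k_module module_End_ext,
    unfold KE.alg.k_module_simps)
  note simps = Phi_add Phi_lact Phi_lie Phi_zero snd_add snd_zero snd_lact snd_lie
    LL.br_add_left[simplified] LL.br_add_right[simplified]
    LL.br_smult_left[simplified] LL.br_smult_right[simplified]
    LL.br_alt[simplified] LL.br_jacobi[simplified]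
  fix w z assume w: "w \<in> carrier X" and z: "z \<in> carrier X"
  show "lie X w z \<in> carrier X" using w z by simp
  show "lie X w w = \<zero>\<^bsub>X\<^esub>"
    by (rule End_ext_eqI) (use w in \<open>simp_all add: simps KE.S.commutator_self\<close>)
  \<comment> \<open>Scalars coming from \<open>k\<close> are central in \<open>S\<close>, so the
    extra term in the product rule for commutators drops out.\<close>
  have central: "commutator KE.S (KE.sc (s \<odot>\<^bsub>A\<^esub> \<one>\<^bsub>A\<^esub>)) g = \<zero>\<^bsub>KE.S\<^esub>"
    "commutator KE.S g (KE.sc (s \<odot>\<^bsub>A\<^esub> \<one>\<^bsub>A\<^esub>)) = \<zero>\<^bsub>KE.S\<^esub>"
    if "s \<in> carrier k" "g \<in> End_k k A E" for s g
    using that by (simp_all add: KE.S.commutator_eq_0_iff KE.scalar_k)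
  show "lie X (lact k A X (s \<odot>\<^bsub>A\<^esub> \<one>\<^bsub>A\<^esub>) w) z = lact k A X (s \<odot>\<^bsub>A\<^esub> \<one>\<^bsub>A\<^esub>) (lie X w z)"
    if "s \<in> carrier k" for s
    by (rule End_ext_eqI)
      (use w z that in \<open>simp_all add: simps KE.S.commutator_mult_left central\<close>)
  show "lie X w (lact k A X (s \<odot>\<^bsub>A\<^esub> \<one>\<^bsub>A\<^esub>) z) = lact k A X (s \<odot>\<^bsub>A\<^esub> \<one>\<^bsub>A\<^esub>) (lie X w z)"
    if "s \<in> carrier k" for s
    by (rule End_ext_eqI)
      (use w z that in \<open>simp_all add: simps KE.S.commutator_mult_right central\<close>)
  fix y assume y: "y \<in> carrier X"
  show "lie X (w \<oplus>\<^bsub>X\<^esub> z) y = lie X w y \<oplus>\<^bsub>X\<^esub> lie X z y"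
    by (rule End_ext_eqI) (use w z y in \<open>simp_all add: simps KE.S.commutator_add_left\<close>)
  show "lie X w (z \<oplus>\<^bsub>X\<^esub> y) = lie X w z \<oplus>\<^bsub>X\<^esub> lie X w y"
    by (rule End_ext_eqI) (use w z y in \<open>simp_all add: simps KE.S.commutator_add_right\<close>)
  show "lie X w (lie X z y) \<oplus>\<^bsub>X\<^esub> lie X z (lie X y w) \<oplus>\<^bsub>X\<^esub> lie X y (lie X w z) = \<zero>\<^bsub>X\<^esub>"
    by (rule End_ext_eqI) (use w z y in \<open>simp_all add: simps KE.S.commutator_jacobi\<close>)
qed

lemma cent_End_ext_closed [simp]: "cent X \<in> carrier X"
  by (simp add: End_ext_simps cent_closed)

lemma Phi_cent: "\<Phi> (cent X) = \<one>\<^bsub>KE.S\<^esub>"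
  by (simp add: Phi_eq rho_cent_one)

text \<open>In \<open>S\<close> the central element becomes 1, so centrality reads [1, x] = 0, the
  Leibniz rule is the product rule for commutators, and the relation for \<open>dact\<close> is
  \<open>Phi_commutator\<close>. What concerns \<open>alpha\<close> and \<open>anchor\<close> is
  pulled back along \<open>snd\<close>.\<close>

lemma D_Lie_algebra_End_ext: "D_Lie_algebra k A f X"
proof (rule D_Lie_algebra.intro)
  show "alpha X \<in> mod_hom T X (D1_module k A)"
    unfolding End_ext_simps by (rule mod_hom_comp[OF snd_hom alpha_hom])
  show "anchor X \<in> mod_hom T X (Der_module k A)"
    unfolding End_ext_simps by (rule mod_hom_comp[OF snd_hom anchor_hom])
  show "anchor X w = snd (alpha X w)" if "w \<in> carrier X" for w
    using that by (simp add: anchor_alpha)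
  show "anchor X (cent X) = (\<lambda>a \<in> carrier A. \<zero>\<^bsub>A\<^esub>)"
    by (simp add: cent_anchor)
  show "lie X (cent X) w = \<zero>\<^bsub>X\<^esub>" if "w \<in> carrier X" for w
    by (rule End_ext_eqI)
      (use that in \<open>simp_all add: Phi_lie Phi_cent Phi_zero snd_lie snd_zero cent_central
        KE.S.commutator_eq_0_iff del: End_ext_simps(8)\<close>, simp_all add: cent_central)
  fix w a assume w: "w \<in> carrier X" and a: "a \<in> carrier A"
  show "dact k A X a w = lact k A X (anchor X w a) (cent X)"
  proof (rule End_ext_eqI)
    show "\<Phi> (dact k A X a w) = \<Phi> (lact k A X (anchor X w a) (cent X))"
      using w a Phi_commutator[OF w a, unfolded commutator_def]
      by (simp add: KE.alg.dact_eq[OF module_End_ext] Phi_diff Phi_tens Phi_lact Phi_cent KE.scalar_one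
          del: End_ext_simps(8))
    \<comment> \<open>\<open>snd_hom\<close> yields linearity only for scalars in the carrier of
      \<open>T\<close>.\<close>
    have "tens k A \<one>\<^bsub>A\<^esub> a \<ominus>\<^bsub>T\<^esub> tens k A a \<one>\<^bsub>A\<^esub> \<in> carrier T"
      using a by (intro LM.R.minus_closed) simp_all
    then have "snd (dact k A X a w) = dact k A L a (snd w)"
      using snd_hom w by (auto simp: dact_def mod_hom_def)
    then show "snd (dact k A X a w) = snd (lact k A X (anchor X w a) (cent X))"
      using w a by (simp add: dact_cent snd_lact del: End_ext_simps(8)) simp
  qed (use w a in \<open>simp_all add: dact_def LM.R.minus_closed del: End_ext_simps(8)\<close>)
  fix z assume z: "z \<in> carrier X"
  show "lie X w (lact k A X a z) = lact k A X a (lie X w z) \<oplus>\<^bsub>X\<^esub> lact k A X (anchor X w a) z"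
  proof (rule End_ext_eqI)
    show "\<Phi> (lie X w (lact k A X a z)) = \<Phi> (lact k A X a (lie X w z) \<oplus>\<^bsub>X\<^esub> lact k A X (anchor X w a) z)"
      using w z a
      by (simp add: Phi_lie Phi_lact Phi_add KE.S.commutator_mult_right Phi_commutator KE.S.a_comm)
  qed (use w z a in \<open>simp_all add: snd_lie snd_lact snd_add lie_leibniz\<close>)
qed (simp_all add: algebra cocycle P_module_End_ext lie_algebra_End_ext snd_lie alpha_lie anchor_lie
    del: End_ext_simps(8))

section \<open>Flatness, exactness and the correspondence with sections\<close>

lemma flat_rho_shriek: "flat_L_connection k A f X E \<Phi>"
proof (intro flat_L_connection.intro L_connection.intro L_connection_axioms.intro
    flat_L_connection_axioms.intro D_Lie_algebra_End_ext module_axioms Phi_hom)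
  show "curvature k A X E \<Phi> w z = \<zero>\<^bsub>KE.S\<^esub>" if "w \<in> carrier X" "z \<in> carrier X" for w z
    using that by (simp add: curvature_def Phi_lie KE.S.diff_self)
qed

lemma p_E_eq: "p_E = snd"
  by (simp add: p_E_def fun_eq_iff)

lemma p_E_hom: "p_E \<in> D_Lie_hom k A X L"
  unfolding D_Lie_hom_def p_E_eq by (simp add: snd_hom snd_lie)

lemma short_exact_End_ext:
  "short_exact T (End_A_module A E) (\<lambda>\<phi>. (\<phi>, \<zero>\<^bsub>L\<^esub>)) X p_E L"
proof -
  have "(\<lambda>\<phi>. (\<phi>, \<zero>\<^bsub>L\<^esub>)) \<in> mod_hom T (End_A_module A E) X"
    by (rule KE.alg.mod_homI[OF module_End_A module_End_ext])
      (simp_all add: smult_End_ext_tens smult_End_A_tens End_ext_simps(1-3))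
  moreover have "(\<lambda>\<phi>. (\<phi>, \<zero>\<^bsub>L\<^esub>)) ` End_A A E = a_kernel X L snd"
    by (auto simp: a_kernel_def' End_ext_simps(1))
  moreover have "snd ` carrier X = carrier L"
    using End_A_closed(2) unfolding End_ext_simps(1) snd_image_times by (metis empty_iff)
  ultimately show ?thesis
    unfolding short_exact_def p_E_eq
    using module_End_A module_End_ext module_L snd_hom by (auto simp: inj_on_def)
qed

text \<open>\<open>s\<close> preserves brackets and \<open>\<Phi>\<close> turns them into
  commutators, so the composite has zero curvature; \<open>cent L\<close> goes to
  \<open>cent X\<close> and from there to 1.\<close>

lemma flat_connection_of_section:
  assumes s: "s \<in> D_Lie_hom k A L X" and p: "\<And>u. u \<in> carrier L \<Longrightarrow> p_E (s u) = u"
  shows "flat_L_connection k A f L E (\<lambda>u. \<Phi> (s u))" "\<Phi> (s (cent L)) = (\<lambda>e \<in> carrier E. e)"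
proof -
  have hom: "s \<in> mod_hom T L X" and lie: "\<And>u v. u \<in> carrier L \<Longrightarrow> v \<in> carrier L \<Longrightarrow> s (lie L u v) = lie X (s u) (s v)"
    and cent: "s (cent L) = cent X"
    using s by (auto simp: D_Lie_hom_def simp del: End_ext_simps)
  have closed: "s u \<in> carrier X" if "u \<in> carrier L" for u
    using hom that by (auto simp: mod_hom_def)
  show "flat_L_connection k A f L E (\<lambda>u. \<Phi> (s u))"
  proof (intro flat_L_connection.intro L_connection.intro L_connection_axioms.intro
      flat_L_connection_axioms.intro D_Lie_algebra_axioms module_axioms mod_hom_comp[OF hom Phi_hom])
    show "curvature k A L E (\<lambda>u. \<Phi> (s u)) u v = \<zero>\<^bsub>KE.S\<^esub>" if "u \<in> carrier L" "v \<in> carrier L" for u v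
      using that by (simp add: curvature_def lie Phi_lie closed KE.S.diff_self)
  qed
  show "\<Phi> (s (cent L)) = (\<lambda>e \<in> carrier E. e)"
    unfolding cent Phi_cent by (simp add: fun_ring_def)
qed

lemma section_of_flat_connection:
  assumes "flat_L_connection k A f L E \<rho>'" and cent: "\<rho>' (cent L) = (\<lambda>e \<in> carrier E. e)"
  shows "\<exists>s \<in> D_Lie_hom k A L X. \<forall>u \<in> carrier L. p_E (s u) = u"
proof
  interpret F: flat_L_connection k A f L E \<rho>' by fact
  \<comment> \<open>With \<open>\<rho>'\<close> in the same locale, \<open>F.rho_commutator\<close>
    gives it the same commutators with scalars as \<open>\<rho>\<close>.\<close>
  interpret F: unital_connection k A f L E \<rho>' by unfold_locales (rule cent)
  \<comment> \<open>The only choice with \<open>\<Phi> (s u) = \<rho>' u\<close> and second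
    component \<open>u\<close>. Through the embedding, each law for \<open>s\<close> becomes the
    corresponding law for \<open>\<rho>'\<close>.\<close>
  define s where "s u = (\<rho>' u \<ominus>\<^bsub>KE.S\<^esub> \<rho> u, u)" for u
  have snd_s: "snd (s u) = u" for u
    by (simp add: s_def)
  have closed: "s u \<in> carrier X" if u: "u \<in> carrier L" for u
  proof -
    have "\<rho>' u \<ominus>\<^bsub>KE.S\<^esub> \<rho> u \<in> End_A A E"
      using u unfolding KE.End_A_iff_commutator
      by (simp add: KE.S.commutator_diff_left rho_commutator F.rho_commutator KE.S.diff_self)
    then show ?thesis
      using u by (simp add: s_def End_ext_simps)
  qed
  have Phi: "\<Phi> (s u) = \<rho>' u" if "u \<in> carrier L" for u
    using that by (simp add: s_def Phi_eq KE.S.diff_add_cancel)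
  have hom: "s \<in> mod_hom T L X"
  proof (rule KE.alg.mod_homI[OF module_L module_End_ext closed])
    fix u assume u: "u \<in> carrier L"
    show "s (u \<oplus>\<^bsub>L\<^esub> v) = s u \<oplus>\<^bsub>X\<^esub> s v" if v: "v \<in> carrier L" for v
      by (rule End_ext_eqI)
        (use u v in \<open>simp_all add: Phi Phi_add closed snd_s snd_add F.rho_add\<close>)
    show "s (tens k A a b \<odot>\<^bsub>L\<^esub> u) = tens k A a b \<odot>\<^bsub>X\<^esub> s u" if "a \<in> carrier A" "b \<in> carrier A" for a b
      by (rule End_ext_eqI)
        (use u that in \<open>simp_all add: Phi Phi_tens closed snd_s snd_smult_tens F.rho_tens\<close>)
  qed
  have lie: "s (lie L u v) = lie X (s u) (s v)" if u: "u \<in> carrier L" and v: "v \<in> carrier L" for u v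
  proof (rule End_ext_eqI)
    \<comment> \<open>Flatness of \<open>\<rho>'\<close> enters here: it is what makes
      \<open>s\<close> respect brackets.\<close>
    have "commutator KE.S (\<rho>' u) (\<rho>' v) = \<rho>' (lie L u v)"
      using F.flat[OF u v] u v by (simp add: curvature_def KE.S.diff_eq_0_iff)
    then show "\<Phi> (s (lie L u v)) = \<Phi> (lie X (s u) (s v))"
      using u v by (simp add: Phi Phi_lie closed)
  qed (use u v in \<open>simp_all add: closed snd_s snd_lie\<close>)
  have "s (cent L) = cent X"
    by (simp add: s_def F.rho_cent_one rho_cent_one KE.S.diff_self)
  then show "s \<in> D_Lie_hom k A L X"
    unfolding D_Lie_hom_def using hom lie by (simp add: snd_s)
  show "\<forall>u \<in> carrier L. p_E (s u) = u"
    by (simp add: p_E_eq snd_s)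
qed

end

theorem theorem4p19:
  fixes k :: "('k, 'x) ring_scheme" and A :: "('k, 'a, 'y) module_scheme"
    and f :: "('a \<Rightarrow> 'a) \<Rightarrow> ('a \<Rightarrow> 'a) \<Rightarrow> 'a" and L :: "('a, 'l, 'z) dlie_scheme"
    and E :: "('a, 'e, 'w) module_scheme" and \<rho> :: "'l \<Rightarrow> 'e \<Rightarrow> 'e"
  assumes "D_Lie_algebra k A f L"
    and "L_connection k A f L E \<rho>"
    and "\<rho> (cent L) = (\<lambda>e \<in> carrier E. e)"
  shows "flat_L_connection k A f (End_ext k A L E \<rho>) E (rho_shriek E \<rho>)
    \<and> (short_exact (tensor_ring k A)
          (End_A_module A E) (\<lambda>\<phi>. (\<phi>, \<zero>\<^bsub>L\<^esub>)) (End_ext k A L E \<rho>) p_E L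
       \<and> p_E \<in> D_Lie_hom k A (End_ext k A L E \<rho>) L)
    \<and> ((\<exists>s \<in> D_Lie_hom k A L (End_ext k A L E \<rho>). \<forall>u \<in> carrier L. p_E (s u) = u)
       \<longleftrightarrow> (\<exists>\<rho>'. flat_L_connection k A f L E \<rho>' \<and> \<rho>' (cent L) = (\<lambda>e \<in> carrier E. e)))"
proof -
  interpret unital_connection k A f L E \<rho>
    using assms(2,3) by (intro unital_connection.intro unital_connection_axioms.intro)
  show ?thesis
    using flat_rho_shriek short_exact_End_ext p_E_hom flat_connection_of_section section_of_flat_connection
    by blast
qed

end
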